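(* (i) If there is a complete revolution surface of constant Gaussian curvature $K$ in $\mathbb{H}^2\times\mathbb{R}$, then $K\geq-1$. (ii) For every constant $c>0$ there exists, up to isometries of $\mathbb{H}^2\times\mathbb{R}$, a unique complete revolution surface of constant Gaussian curvature $c$ in $\mathbb{H}^2\times\mathbb{R}$.
   Context: $\mathbb{H}^2=\{(x_1,x_2,x_3)\in\mathbb{R}^3:-x_1^2+x_2^2+x_3^2=-1,\ x_1>0\}$ with the metric induced by $-dx_1^2+dx_2^2+dx_3^2$ (curvature $-1$), and $\mathbb{H}^2\times\mathbb{R}$ carries the product metric. The group $SO(2)$ acts as the rotations of $\mathbb{H}^2\times\mathbb{R}$ fixing every point of an axis $\{p\}\times\mathbb{R}$, $p\in\mathbb{H}^2$; up to isometry the axis is $\{(1,0,0)\}\times\mathbb{R}$. A revolution surface is the smooth immersed surface obtained by rotating about the axis a smooth regular curve $\alpha$ contained in $\mathcal{P}=\{(x_1,x_2,x_3,x_4)\in\mathbb{H}^2\times\mathbb{R}: x_2\geq0,\ x_3=0\}$, where $\alpha$ does not meet the axis except possibly at its initial or end points, and meets it orthogonally there. Explicitly, $\alpha(u)=(\cosh k(u),\sinh k(u),0,h(u))$ with $k\ge 0$ and $u$ arc length, and the surface is $\psi(u,v)=(\cosh k(u),\sinh k(u)\cos v,\sinh k(u)\sin v,h(u))$. It is complete if its induced Riemannian metric is complete; Gaussian curvature is the intrinsic curvature of the induced metric. *)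

theory Defs
  imports "HOL-Analysis.Analysis"
begin

section \<open>Ambient space\<close>

text \<open>The form \<open>- dx1^2 + dx2^2 + dx3^2 + dx4^2\<close>, with \<open>R^4\<close> written as \<open>(real^3) \<times> real\<close>.
  It is positive definite on vectors tangent to \<open>H2xR\<close>.\<close>

definition ambient_form :: "(real^3) \<times> real \<Rightarrow> (real^3) \<times> real \<Rightarrow> real" where
  "ambient_form a b =
     - (fst a $ 1 * fst b $ 1) + fst a $ 2 * fst b $ 2 + fst a $ 3 * fst b $ 3 + snd a * snd b"

definition hyperboloid :: "(real^3) set" where
  "hyperboloid = {x. - (x $ 1)\<^sup>2 + (x $ 2)\<^sup>2 + (x $ 3)\<^sup>2 = -1 \<and> 0 < x $ 1}"

definition H2xR :: "((real^3) \<times> real) set" where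
  "H2xR = hyperboloid \<times> UNIV"

section \<open>Length, distance and completeness of the metric induced by an immersion\<close>

text \<open>In this section an immersed manifold is a set \<open>M\<close>, carrying its manifold topology as a
  subspace, and a map \<open>f\<close> of \<open>M\<close> into the ambient space. A curve \<open>\<gamma>\<close> in \<open>M\<close> is piecewise \<open>C^1\<close>
  for the smooth structure of \<open>M\<close> iff it is continuous and \<open>f \<circ> \<gamma>\<close> is piecewise \<open>C^1\<close>,
  because \<open>f\<close> is an immersion.\<close>

definition speed :: "('a \<Rightarrow> (real^3) \<times> real) \<Rightarrow> (real \<Rightarrow> 'a) \<Rightarrow> real \<Rightarrow> real" where
  "speed f \<gamma> t = (let w = vector_derivative (f \<circ> \<gamma>) (at t) in sqrt (ambient_form w w))"

text \<open>The library's \<open>valid_path\<close> admits derivatives that are unbounded near the finitely many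
  exceptional times. The integrability condition removes the curves of infinite length, to which
  \<open>integral\<close> would assign length 0.\<close>

definition curves_between ::
  "'a::topological_space set \<Rightarrow> ('a \<Rightarrow> (real^3) \<times> real) \<Rightarrow> 'a \<Rightarrow> 'a \<Rightarrow> (real \<Rightarrow> 'a) set" where
  "curves_between M f x y =
     {\<gamma>. path \<gamma> \<and> path_image \<gamma> \<subseteq> M \<and> pathstart \<gamma> = x \<and> pathfinish \<gamma> = y \<and>
         valid_path (f \<circ> \<gamma>) \<and> speed f \<gamma> integrable_on {0..1}}"

definition curve_length :: "('a \<Rightarrow> (real^3) \<times> real) \<Rightarrow> (real \<Rightarrow> 'a) \<Rightarrow> real" where
  "curve_length f \<gamma> = integral {0..1} (speed f \<gamma>)"

definition riem_dist ::
  "'a::topological_space set \<Rightarrow> ('a \<Rightarrow> (real^3) \<times> real) \<Rightarrow> 'a \<Rightarrow> 'a \<Rightarrow> real" where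
  "riem_dist M f x y = (INF \<gamma> \<in> curves_between M f x y. curve_length f \<gamma>)"

definition riem_complete ::
  "'a::topological_space set \<Rightarrow> ('a \<Rightarrow> (real^3) \<times> real) \<Rightarrow> bool" where
  "riem_complete M f \<longleftrightarrow>
     (\<forall>\<sigma>::nat \<Rightarrow> 'a.
        (\<forall>n. \<sigma> n \<in> M) \<and>
        (\<forall>\<epsilon>>0. \<exists>N. \<forall>m\<ge>N. \<forall>n\<ge>N. riem_dist M f (\<sigma> m) (\<sigma> n) < \<epsilon>) \<longrightarrow>
        (\<exists>x\<in>M. (\<lambda>n. riem_dist M f (\<sigma> n) x) \<longlonglongrightarrow> 0))"

text \<open>Isometries as distance-preserving bijections; by Myers--Steenrod these are the Riemannian
  isometries of the product metric.\<close>

definition ambient_isometry :: "((real^3) \<times> real \<Rightarrow> (real^3) \<times> real) \<Rightarrow> bool" where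
  "ambient_isometry \<Phi> \<longleftrightarrow>
     bij_betw \<Phi> H2xR H2xR \<and>
     (\<forall>x\<in>H2xR. \<forall>y\<in>H2xR.
        riem_dist H2xR (\<lambda>p. p) (\<Phi> x) (\<Phi> y) = riem_dist H2xR (\<lambda>p. p) x y)"

text \<open>Equality of immersed manifolds up to reparametrisation and ambient isometry. The
  homeomorphism is automatically a diffeomorphism when \<open>f\<close> and \<open>g\<close> are immersions.\<close>

definition congruent_immersions ::
  "'a::topological_space set \<Rightarrow> ('a \<Rightarrow> (real^3) \<times> real) \<Rightarrow>
   'b::topological_space set \<Rightarrow> ('b \<Rightarrow> (real^3) \<times> real) \<Rightarrow> bool" where
  "congruent_immersions M f N g \<longleftrightarrow>
     (\<exists>\<Phi> \<phi> \<phi>'. ambient_isometry \<Phi> \<and> homeomorphism M N \<phi> \<phi>' \<and> (\<forall>x\<in>M. g (\<phi> x) = \<Phi> (f x)))"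

section \<open>Smoothness\<close>

primrec Ck_on ::
  "nat \<Rightarrow> ('a::euclidean_space \<Rightarrow> 'b::real_normed_vector) \<Rightarrow> 'a set \<Rightarrow> bool" where
  "Ck_on 0 f S \<longleftrightarrow> continuous_on S f"
| "Ck_on (Suc n) f S \<longleftrightarrow>
     (\<forall>x\<in>S. f differentiable (at x)) \<and> (\<forall>v. Ck_on n (\<lambda>x. frechet_derivative f (at x) v) S)"

text \<open>Intended for open \<open>S\<close>.\<close>

definition Cinf_on :: "('a::euclidean_space \<Rightarrow> 'b::real_normed_vector) \<Rightarrow> 'a set \<Rightarrow> bool" where
  "Cinf_on f S \<longleftrightarrow> (\<forall>n. Ck_on n f S)"

section \<open>Intrinsic curvature of a metric tensor in two coordinates\<close>

definition pderiv_at ::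
  "'n \<Rightarrow> (real^'n \<Rightarrow> 'b::real_normed_vector) \<Rightarrow> real^'n \<Rightarrow> 'b" where
  "pderiv_at i F p = vector_derivative (\<lambda>t. F (p + t *\<^sub>R axis i 1)) (at 0)"

definition induced_metric :: "(real^2 \<Rightarrow> (real^3) \<times> real) \<Rightarrow> real^2 \<Rightarrow> real^2^2" where
  "induced_metric X p = (\<chi> i j. ambient_form (pderiv_at i X p) (pderiv_at j X p))"

text \<open>\<open>christoffel g l i j\<close> is the coefficient of \<open>\<partial>_l\<close> in \<open>\<nabla>_{\<partial>_i} \<partial>_j\<close> for the Levi-Civita
  connection of \<open>g\<close>, and \<open>riemann g l i j k\<close> is the coefficient of \<open>\<partial>_l\<close> in \<open>R(\<partial>_i, \<partial>_j) \<partial>_k\<close>,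
  where \<open>R(X,Y) = \<nabla>_X \<nabla>_Y - \<nabla>_Y \<nabla>_X - \<nabla>_[X,Y]\<close>.\<close>

definition christoffel :: "(real^2 \<Rightarrow> real^2^2) \<Rightarrow> 2 \<Rightarrow> 2 \<Rightarrow> 2 \<Rightarrow> real^2 \<Rightarrow> real" where
  "christoffel g l i j p =
     1/2 * (\<Sum>m\<in>UNIV. matrix_inv (g p) $ l $ m *
       (pderiv_at i (\<lambda>q. g q $ j $ m) p + pderiv_at j (\<lambda>q. g q $ i $ m) p
        - pderiv_at m (\<lambda>q. g q $ i $ j) p))"

definition riemann :: "(real^2 \<Rightarrow> real^2^2) \<Rightarrow> 2 \<Rightarrow> 2 \<Rightarrow> 2 \<Rightarrow> 2 \<Rightarrow> real^2 \<Rightarrow> real" where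
  "riemann g l i j k p =
     pderiv_at i (christoffel g l j k) p - pderiv_at j (christoffel g l i k) p
     + (\<Sum>m\<in>UNIV. christoffel g l i m p * christoffel g m j k p
                  - christoffel g l j m p * christoffel g m i k p)"

definition gauss_curvature :: "(real^2 \<Rightarrow> real^2^2) \<Rightarrow> real^2 \<Rightarrow> real" where
  "gauss_curvature g p = (\<Sum>l\<in>UNIV. g p $ 1 $ l * riemann g l 1 2 2 p) / det (g p)"

section \<open>Revolution surfaces\<close>

text \<open>\<open>I\<close> is the interval on which the profile curve \<open>(cosh k, sinh k, 0, h)\<close> is defined.\<close>

definition revolve :: "(real \<Rightarrow> real) \<Rightarrow> (real \<Rightarrow> real) \<Rightarrow> real \<Rightarrow> real \<Rightarrow> (real^3) \<times> real" where
  "revolve k h u v =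
     (vector [cosh (k u), sinh (k u) * cos v, sinh (k u) * sin v], h u)"

text \<open>The underlying abstract surface: \<open>I\<close> times a circle, with the circle over a parameter with
  \<open>k = 0\<close> collapsed to a point. The first coordinate keeps apart points with different \<open>u\<close> that
  have the same image under the immersion.\<close>

definition rev_surface :: "real set \<Rightarrow> (real \<Rightarrow> real) \<Rightarrow> (real \<times> real \<times> real) set" where
  "rev_surface I k = {(u, sinh (k u) * cos v, sinh (k u) * sin v) | u v. u \<in> I}"

definition rev_immersion ::
  "(real \<Rightarrow> real) \<Rightarrow> (real \<Rightarrow> real) \<Rightarrow> real \<times> real \<times> real \<Rightarrow> (real^3) \<times> real" where
  "rev_immersion k h = (\<lambda>(u, y, z). (vector [cosh (k u), y, z], h u))"

text \<open>Smooth closing up at an endpoint \<open>a\<close> of \<open>I\<close> lying on the axis; \<open>s\<close> is 1 for an initial and -1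
  for a final endpoint. The first condition is orthogonality to the axis, whose direction is
  \<open>\<partial>/\<partial>x4\<close>. The last one says that the surface is smooth at the pole, in the coordinates given by
  the disc with polar coordinates \<open>(\<bar>u - a\<bar>, v)\<close>; as the profile has unit speed, the patch is then
  an immersion at the origin.\<close>

definition smooth_pole :: "real set \<Rightarrow> (real \<Rightarrow> real) \<Rightarrow> (real \<Rightarrow> real) \<Rightarrow> real \<Rightarrow> bool" where
  "smooth_pole I k h a \<longleftrightarrow>
     (h has_real_derivative 0) (at a within I) \<and>
     (\<exists>s\<in>{-1, 1}. \<exists>r>0. (\<forall>t\<in>{0..<r}. a + s * t \<in> I) \<and>
        Cinf_on (\<lambda>w::complex. revolve k h (a + s * norm w) (Arg w)) (ball 0 r))"

text \<open>An endpoint belonging to \<open>I\<close> must lie on the axis: otherwise the surface would have a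
  boundary circle there.\<close>

definition revolution_surface :: "real set \<Rightarrow> (real \<Rightarrow> real) \<Rightarrow> (real \<Rightarrow> real) \<Rightarrow> bool" where
  "revolution_surface I k h \<longleftrightarrow>
     is_interval I \<and> interior I \<noteq> {} \<and>
     Cinf_on k (interior I) \<and> Cinf_on h (interior I) \<and>
     (\<forall>u\<in>interior I. (deriv k u)\<^sup>2 + (deriv h u)\<^sup>2 = 1) \<and>
     (\<forall>u\<in>interior I. 0 < k u) \<and>
     (\<forall>a\<in>I - interior I. k a = 0 \<and> smooth_pole I k h a)"

text \<open>The curvature is evaluated in the coordinates \<open>(u, v)\<close>, which cover everything except the at
  most two poles; there it is determined by continuity.\<close>

definition constant_gauss_curvature ::
  "real set \<Rightarrow> (real \<Rightarrow> real) \<Rightarrow> (real \<Rightarrow> real) \<Rightarrow> real \<Rightarrow> bool" where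
  "constant_gauss_curvature I k h c \<longleftrightarrow>
     (\<forall>p::real^2. p $ 1 \<in> interior I \<longrightarrow>
        gauss_curvature (induced_metric (\<lambda>q. revolve k h (q $ 1) (q $ 2))) p = c)"

definition complete_revolution_surface_curv ::
  "real set \<Rightarrow> (real \<Rightarrow> real) \<Rightarrow> (real \<Rightarrow> real) \<Rightarrow> real \<Rightarrow> bool" where
  "complete_revolution_surface_curv I k h c \<longleftrightarrow>
     revolution_surface I k h \<and>
     riem_complete (rev_surface I k) (rev_immersion k h) \<and>
     constant_gauss_curvature I k h c"

end

theory Submission
  imports Defs
begin

text \<open>The induced metric is \<open>du^2 + sinh^2 (k u) dv^2\<close>, so \<open>f = sinh k\<close> satisfies \<open>f'' = -K f\<close>, and
  unit speed of the profile gives \<open>f'^2 \<le> 1 + f^2\<close>. Meridians have length \<open>\<bar>\<Delta>u\<bar>\<close>, while the height and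
  \<open>ln x1\<close> vary along any curve by at most its length; hence completeness forces the parameter
  interval \<open>I\<close> to be closed, and \<open>f\<close> vanishes at its end points.
  If \<open>K < -1\<close>, then \<open>f'^2 + K f^2\<close> is constant, so \<open>f\<close> is bounded; it is also convex and positive, with
  zeros at the ends of \<open>I\<close>, which is impossible.
  If \<open>K = c > 0\<close>, then \<open>f\<close> is an arc of a sine, and orthogonality at a pole fixes its amplitude to
  \<open>1 / sqrt c\<close>. So \<open>k\<close> is determined up to translation of \<open>u\<close>, and \<open>h'^2 = 1 - k'^2\<close> has no zeros inside
  \<open>I\<close>, so \<open>h\<close> is determined up to sign and an additive constant.\<close>

section \<open>Calculus of \<open>C^k\<close> functions\<close>

text \<open>The Riemannian distance is never computed. From below it is controlled by functions
  whose differential is at most the length on tangent vectors (the height, the logarithm of the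
  first coordinate, and coordinates divided by a bound for the first one); from above by a single
  explicit curve, linear in \<open>(u, v)\<close>. Closedness of \<open>I\<close> follows because a
  curve from near a missing end to an alleged limit must cross two parameters at which
  \<open>(k, h)\<close> differ. Completeness of the sphere follows from compactness of
  \<open>I\<close> and from the height separating parameters. The obstacle is the poles:
  \<open>(u, v)\<close> degenerates there, the profile is assumed smooth only inside
  \<open>I\<close>, and even continuity of \<open>k\<close> at an end point has to be extracted from
  \<open>smooth_pole\<close>. Hence identities are proved on \<open>interior I\<close> and then
  extended by continuity. For the sphere, h'^2 = 1 - k'^2 gives h' = sqrt (c + 1) sin x / sqrt (c +
  sin^2 x) with x = sqrt c u. This integrates to an arcsine whose argument stays strictly inside
  (-1, 1), so the height is smooth even at the poles.\<close>

lemma Ck_on_cong: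
  assumes "open S" "\<And>x. x \<in> S \<Longrightarrow> f x = g x" "Ck_on n f S"
  shows "Ck_on n g S"
  using assms(2,3)
proof (induction n arbitrary: f g)
  case 0
  then show ?case by (metis Ck_on.simps(1) continuous_on_cong)
next
  case (Suc n)
  have d: "f differentiable (at x)" if "x \<in> S" for x
    using Suc.prems(2) that by simp
  have "g differentiable (at x)" if "x \<in> S" for x
    using has_derivative_transform_within_open[OF _ assms(1) that] d[OF that] Suc.prems(1)
    unfolding differentiable_def by metis
  moreover have "frechet_derivative f (at x) = frechet_derivative g (at x)" if "x \<in> S" for x
    using frechet_derivative_transform_within_open[OF d[OF that] assms(1) that] Suc.prems(1) by blast
  then have "Ck_on n (\<lambda>x. frechet_derivative g (at x) v) S" for v
    using Suc.IH[of "\<lambda>x. frechet_derivative f (at x) v" "\<lambda>x. frechet_derivative g (at x) v"]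
      Suc.prems(2) by simp
  ultimately show ?case by simp
qed

text \<open>\<open>Ck_on\<close> is defined through \<open>frechet_derivative\<close>; uniqueness of
  the derivative lets any explicit \<open>D\<close> take its place.\<close>

lemma Ck_on_SucI:
  assumes "open S" "\<And>x. x \<in> S \<Longrightarrow> (f has_derivative D x) (at x)" "\<And>v. Ck_on n (\<lambda>x. D x v) S"
  shows "Ck_on (Suc n) f S"
proof -
  have "Ck_on n (\<lambda>x. frechet_derivative f (at x) v) S" for v
    by (rule Ck_on_cong[OF assms(1) _ assms(3)[of v]])
      (simp add: frechet_derivative_at[OF assms(2)])
  then show ?thesis
    using assms(2) by (auto simp: differentiable_def)
qed

lemma Ck_on_SucE:
  assumes "Ck_on (Suc n) f S"
  obtains D where "\<forall>x\<in>S. (f has_derivative D x) (at x)" "\<forall>v. Ck_on n (\<lambda>x. D x v) S"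
proof (rule that)
  show "\<forall>x\<in>S. (f has_derivative frechet_derivative f (at x)) (at x)"
    using assms by (simp add: frechet_derivative_works)
qed (use assms in simp)

lemma Ck_on_Suc_imp: "Ck_on (Suc n) f S \<Longrightarrow> Ck_on n f S"
proof (induction n arbitrary: f)
  case 0
  then show ?case
    by (auto intro!: continuous_at_imp_continuous_on differentiable_imp_continuous_within)
next
  case (Suc n)
  then show ?case by (metis Ck_on.simps(2))
qed

lemma Ck_on_const: "Ck_on n (\<lambda>x. c) S"
  by (induction n arbitrary: c) (auto simp: frechet_derivative_const)

lemma Ck_on_bounded_linear:
  assumes "open S" "bounded_linear f"
  shows "Ck_on n f S"
proof (cases n)
  case 0
  then show ?thesis using assms(2) by (simp add: linear_continuous_on)
next
  case (Suc m)
  show ?thesis unfolding Suc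
    by (rule Ck_on_SucI[OF assms(1) bounded_linear_imp_has_derivative[OF assms(2)] Ck_on_const])
qed

lemma Ck_on_ident: "open S \<Longrightarrow> Ck_on n (\<lambda>x. x) S"
  by (intro Ck_on_bounded_linear bounded_linear_ident)

lemma Ck_on_add:
  assumes "open S" "Ck_on n f S" "Ck_on n g S"
  shows "Ck_on n (\<lambda>x. f x + g x) S"
  using assms(2,3)
proof (induction n arbitrary: f g)
  case 0
  then show ?case by (simp add: continuous_on_add)
next
  case (Suc n)
  obtain D where D: "\<forall>x\<in>S. (f has_derivative D x) (at x)" "\<forall>v. Ck_on n (\<lambda>x. D x v) S"
    using Suc.prems(1) by (rule Ck_on_SucE) (rule that)
  obtain E where E: "\<forall>x\<in>S. (g has_derivative E x) (at x)" "\<forall>v. Ck_on n (\<lambda>x. E x v) S"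
    using Suc.prems(2) by (rule Ck_on_SucE) (rule that)
  show ?case
    by (rule Ck_on_SucI[OF assms(1) has_derivative_add[OF bspec[OF D(1)] bspec[OF E(1)]]]) (assumption | rule Suc.IH[OF spec[OF D(2)] spec[OF E(2)]])+
qed

lemma Ck_on_scaleR:
  fixes f :: "'a::euclidean_space \<Rightarrow> real" and g :: "'a \<Rightarrow> 'b::real_normed_vector"
  assumes "open S" "Ck_on n f S" "Ck_on n g S"
  shows "Ck_on n (\<lambda>x. f x *\<^sub>R g x) S"
  using assms(2,3)
proof (induction n arbitrary: f g)
  case 0
  then show ?case by (simp add: continuous_on_scaleR)
next
  case (Suc n)
  obtain D where D: "\<forall>x\<in>S. (f has_derivative D x) (at x)" "\<forall>v. Ck_on n (\<lambda>x. D x v) S"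
    using Suc.prems(1) by (rule Ck_on_SucE) (rule that)
  obtain E where E: "\<forall>x\<in>S. (g has_derivative E x) (at x)" "\<forall>v. Ck_on n (\<lambda>x. E x v) S"
    using Suc.prems(2) by (rule Ck_on_SucE) (rule that)
  show ?case
    by (rule Ck_on_SucI[OF assms(1) has_derivative_scaleR[OF bspec[OF D(1)] bspec[OF E(1)]]])
      (assumption | rule Ck_on_add[OF assms(1) Suc.IH[OF Ck_on_Suc_imp[OF Suc.prems(1)] spec[OF E(2)]]
          Suc.IH[OF spec[OF D(2)] Ck_on_Suc_imp[OF Suc.prems(2)]]])+
qed

lemma Ck_on_mult:
  fixes f g :: "'a::euclidean_space \<Rightarrow> real"
  assumes "open S" "Ck_on n f S" "Ck_on n g S"
  shows "Ck_on n (\<lambda>x. f x * g x) S"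
  using Ck_on_scaleR[OF assms] by simp

lemma Ck_on_compose:
  fixes f :: "'a::euclidean_space \<Rightarrow> real" and g :: "real \<Rightarrow> real"
  assumes "open S" "f ` S \<subseteq> T" "Ck_on n g T" "Ck_on n f S"
  shows "Ck_on n (\<lambda>x. g (f x)) S"
  using assms(3,4)
proof (induction n arbitrary: g)
  case 0
  then show ?case using assms(2) by (auto intro: continuous_on_compose2)
next
  case (Suc n)
  obtain D where D: "\<forall>x\<in>S. (f has_derivative D x) (at x)" "\<forall>v. Ck_on n (\<lambda>x. D x v) S"
    using Suc.prems(2) by (rule Ck_on_SucE) (rule that)
  obtain E where E: "\<forall>x\<in>T. (g has_derivative E x) (at x)" "\<forall>v. Ck_on n (\<lambda>x. E x v) T"
    using Suc.prems(1) by (rule Ck_on_SucE) (rule that)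
  \<comment> \<open>With a real inner function the chain rule factors into \<open>D x v\<close>
    times the outer derivative \<open>E (f x) 1\<close>, so the induction reduces to
    products.\<close>
  have "((\<lambda>x. g (f x)) has_derivative (\<lambda>v. D x v * E (f x) 1)) (at x)" if "x \<in> S" for x
  proof -
    have E1: "(g has_derivative E (f x)) (at (f x))" using E(1) assms(2) that by blast
    have "E (f x) (D x v) = D x v * E (f x) 1" for v
      using linear_scale[OF has_derivative_linear[OF E1], of "D x v" 1] by simp
    then have "(\<lambda>v. E (f x) (D x v)) = (\<lambda>v. D x v * E (f x) 1)" by (rule ext)
    then show ?thesis
      using has_derivative_compose[OF bspec[OF D(1) that] E1] by simp
  qed
  then show ?case
    by (rule Ck_on_SucI[OF assms(1)])
      (simp_all add: Ck_on_mult[OF assms(1) spec[OF D(2)] Suc.IH[OF spec[OF E(2)] Ck_on_Suc_imp[OF Suc.prems(2)]]])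
qed

lemma Ck_on_Suc_real:
  fixes f :: "real \<Rightarrow> real"
  assumes "open S" "\<And>x. x \<in> S \<Longrightarrow> (f has_real_derivative f' x) (at x)" "Ck_on n f' S"
  shows "Ck_on (Suc n) f S"
  by (rule Ck_on_SucI[OF assms(1) assms(2)[unfolded has_field_derivative_def]])
    (auto intro!: Ck_on_mult assms Ck_on_const)

lemma Ck_on_imp_deriv:
  fixes f :: "real \<Rightarrow> real"
  assumes "open S" "Ck_on (Suc n) f S"
  shows "x \<in> S \<Longrightarrow> (f has_real_derivative deriv f x) (at x)" "Ck_on n (deriv f) S"
proof -
  have d: "f differentiable (at x)" if "x \<in> S" for x using assms that by simp
  show *: "(f has_real_derivative deriv f x) (at x)" if "x \<in> S" for x
    using d[OF that] by (simp add: DERIV_deriv_iff_real_differentiable)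
  have "frechet_derivative f (at x) 1 = deriv f x" if "x \<in> S" for x
    using fun_cong[OF frechet_derivative_at[OF *[OF that, unfolded has_field_derivative_def]], of 1]
    by simp
  moreover have "Ck_on n (\<lambda>x. frechet_derivative f (at x) 1) S" using assms by simp
  ultimately show "Ck_on n (deriv f) S" by (intro Ck_on_cong[OF assms(1), of _ "deriv f"])
qed

section \<open>Smoothness of the elementary functions in the sphere profile\<close>

text \<open>Differentiation stays within powers, so the induction keeps \<open>a\<close> arbitrary.
  The exponents 1/2 and -1/2 give \<open>sqrt\<close> and the derivatives of \<open>arcsin\<close>
  and \<open>arsinh\<close>.\<close>

lemma Ck_on_powr: "Ck_on n (\<lambda>x::real. x powr a) {0<..}"
proof (induction n arbitrary: a)
  case 0
  then show ?case by (auto intro!: continuous_intros)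
next
  case (Suc n)
  show ?case
    by (rule Ck_on_Suc_real[where f' = "\<lambda>x. a * x powr (a - 1)"])
      (auto intro!: Ck_on_mult Ck_on_const Suc.IH has_real_derivative_powr)
qed

text \<open>Termwise differentiation turns \<open>c\<close> into \<open>diffs c\<close>, again with
  an everywhere convergent series, so the induction runs over all \<open>c\<close> at once. It
  covers \<open>sin\<close>, \<open>cos\<close> and the series in the squared radius used at the
  poles.\<close>

lemma Ck_on_powser:
  fixes c :: "nat \<Rightarrow> real"
  assumes "\<And>x. summable (\<lambda>n. c n * x ^ n)"
  shows "Ck_on n (\<lambda>x. \<Sum>i. c i * x ^ i) UNIV"
  using assms
proof (induction n arbitrary: c)
  case 0
  then show ?case
    by (auto intro!: continuous_at_imp_continuous_on DERIV_isCont
        termdiffs_strong_converges_everywhere)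
next
  case (Suc n)
  show ?case
    by (rule Ck_on_Suc_real[where f' = "\<lambda>x. \<Sum>i. diffs c i * x ^ i"])
      (simp_all add: termdiffs_strong_converges_everywhere[OF Suc.prems]
        Suc.IH[OF termdiff_converges_all[OF Suc.prems]])
qed

lemma Ck_on_sin: "Ck_on n (sin :: real \<Rightarrow> real) UNIV"
  using Ck_on_powser[of sin_coeff n] summable_norm_sin[THEN summable_norm_cancel, of "_::real"]
  by (simp add: sin_def[abs_def])

lemma Ck_on_cos: "Ck_on n (cos :: real \<Rightarrow> real) UNIV"
  using Ck_on_powser[of cos_coeff n] summable_norm_cos[THEN summable_norm_cancel, of "_::real"]
  by (simp add: cos_def[abs_def])

lemma Ck_on_sqrt: "Ck_on n sqrt {0<..}"
  by (rule Ck_on_cong[OF _ _ Ck_on_powr[of n "1/2"]]) (auto simp: powr_half_sqrt)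

text \<open>The derivative is the power -1/2 of a polynomial positive on the open interval, so order
  \<open>Suc m\<close> reduces to \<open>Ck_on_powr\<close>.\<close>

lemma Ck_on_arcsin: "Ck_on n arcsin {-1<..<1}"
proof (cases n)
  case 0
  then show ?thesis
    by (auto intro!: continuous_intros)
next
  case (Suc m)
  have q: "0 < 1 + (-1) * (x * x)" if "x \<in> {-1<..<1}" for x :: real
    using that abs_square_less_1[of x] by (auto simp: power2_eq_square abs_less_iff)
  have "Ck_on m (\<lambda>x::real. 1 + (-1) * (x * x)) {-1<..<1}"
    by (intro Ck_on_add Ck_on_mult Ck_on_const Ck_on_ident open_greaterThanLessThan)
  then have "Ck_on m (\<lambda>x. (1 + (-1) * (x * x)) powr (-1/2)) {-1<..<1::real}"
    using q by (intro Ck_on_compose[OF _ _ Ck_on_powr]) auto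
  moreover have "(arcsin has_real_derivative (1 + (-1) * (x * x)) powr (-1/2)) (at x)"
    if "x \<in> {-1<..<1}" for x
    using DERIV_arcsin[of x] that q[of x]
    by (simp add: powr_minus powr_half_sqrt power2_eq_square)
  ultimately show ?thesis unfolding Suc
    by (intro Ck_on_Suc_real[OF open_greaterThanLessThan])
qed

lemma Ck_on_arsinh: "Ck_on n (arsinh :: real \<Rightarrow> real) UNIV"
proof (cases n)
  case 0
  then show ?thesis
    by (auto intro!: continuous_intros)
next
  case (Suc m)
  have q: "0 < x * x + 1" for x :: real
    by (simp add: add_nonneg_pos)
  have "Ck_on m (\<lambda>x::real. x * x + 1) UNIV"
    by (intro Ck_on_add Ck_on_mult Ck_on_const Ck_on_ident open_UNIV)
  then have "Ck_on m (\<lambda>x. (x * x + 1) powr (-1/2)) (UNIV::real set)"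
    using q by (intro Ck_on_compose[OF _ _ Ck_on_powr]) auto
  moreover have "(arsinh has_real_derivative (x * x + 1) powr (-1/2)) (at x)" for x :: real
    using arsinh_real_has_field_derivative[of x UNIV] q[of x]
    by (simp add: powr_minus powr_half_sqrt power2_eq_square inverse_eq_divide)
  ultimately show ?thesis unfolding Suc
    by (intro Ck_on_Suc_real[OF open_UNIV])
qed

section \<open>Gaussian curvature\<close>

lemma ambient_form_simps:
  "ambient_form (vector [a, b, c], d) (vector [a', b', c'], d') = - (a * a') + b * b' + c * c' + d * d'"
  by (simp add: ambient_form_def)

lemma vector3_has_derivative:
  fixes a b c d :: "real \<Rightarrow> real"
  assumes "(a has_real_derivative a') (at t)" "(b has_real_derivative b') (at t)"
    "(c has_real_derivative c') (at t)" "(d has_real_derivative d') (at t)"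
  shows "((\<lambda>t. (vector [a t, b t, c t] :: real^3, d t)) has_vector_derivative
           (vector [a', b', c'], d')) (at t)"
proof -
  have v: "(vector [x, y, z] :: real^3) = x *\<^sub>R axis 1 1 + y *\<^sub>R axis 2 1 + z *\<^sub>R axis 3 1" for x y z :: real
    by (simp add: vec_eq_iff forall_3 axis_def)
  have "((\<lambda>t. vector [a t, b t, c t] :: real^3) has_vector_derivative vector [a', b', c']) (at t)"
    unfolding v using assms[unfolded has_real_derivative_iff_has_vector_derivative]
    by (auto intro!: derivative_eq_intros simp: has_real_derivative_iff_has_vector_derivative)
  then show ?thesis
    using assms(4) by (intro has_vector_derivative_Pair) (simp_all add: has_real_derivative_iff_has_vector_derivative)
qed

lemma pderiv_at_eqI:
  "((\<lambda>t. F (p + t *\<^sub>R axis i 1)) has_vector_derivative D) (at 0) \<Longrightarrow> pderiv_at i F p = D"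
  unfolding pderiv_at_def by (rule vector_derivative_at)

lemma pderiv_at_1_cong:
  fixes F :: "real^2 \<Rightarrow> real"
  assumes "open S" "p $ 1 \<in> S" "\<And>q. q $ 1 \<in> S \<Longrightarrow> F q = G (q $ 1)"
    "(G has_real_derivative D) (at (p $ 1))"
  shows "pderiv_at 1 F p = D"
proof (rule pderiv_at_eqI, rule has_vector_derivative_transform_within_open)
  show "((\<lambda>t. G (p $ 1 + t)) has_vector_derivative D) (at 0)"
    unfolding has_real_derivative_iff_has_vector_derivative[symmetric]
    using DERIV_shift[of G D 0 "p $ 1"] assms(4) by (simp add: add.commute)
  show "open ((\<lambda>t. p $ 1 + t) -` S)"
    by (rule continuous_open_vimage) (auto intro!: continuous_intros assms)
  show "0 \<in> (\<lambda>t. p $ 1 + t) -` S" using assms(2) by simp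
  show "G (p $ 1 + t) = F (p + t *\<^sub>R axis 1 1)" if "t \<in> (\<lambda>t. p $ 1 + t) -` S" for t
    using that assms(3) by (simp add: axis_def)
qed

text \<open>Moving along the second axis keeps \<open>q $ 1\<close> fixed, so the path stays over
  \<open>S\<close> and \<open>F\<close> is constant on it.\<close>

lemma pderiv_at_2_cong:
  fixes F :: "real^2 \<Rightarrow> real"
  assumes "p $ 1 \<in> S" "\<And>q. q $ 1 \<in> S \<Longrightarrow> F q = G (q $ 1)"
  shows "pderiv_at 2 F p = 0"
  by (rule pderiv_at_eqI) (simp add: assms axis_def)

text \<open>\<open>matrix_inv\<close> is a choice among inverses; exhibiting one and using
  uniqueness of inverses determines its entries.\<close>

lemma matrix_inv_diag2:
  fixes A :: "real^2^2"
  assumes "A $ 1 $ 1 = 1" "A $ 1 $ 2 = 0" "A $ 2 $ 1 = 0" "A $ 2 $ 2 = x" "x \<noteq> 0"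
  shows "matrix_inv A $ 1 $ 1 = 1" "matrix_inv A $ 1 $ 2 = 0"
    "matrix_inv A $ 2 $ 1 = 0" "matrix_inv A $ 2 $ 2 = 1 / x"
proof -
  define B :: "real^2^2" where "B = (\<chi> i j. if i = 1 then (if j = 1 then 1 else 0) else (if j = 1 then 0 else 1 / x))"
  have "A ** B = mat 1" "B ** A = mat 1"
    using assms by (simp_all add: vec_eq_iff matrix_matrix_mult_def forall_2 sum_2 B_def mat_def)
  moreover from this have "A ** matrix_inv A = mat 1"
    unfolding matrix_inv_def by (metis (mono_tags, lifting) someI_ex)
  ultimately have "matrix_inv A = B"
    by (metis matrix_mul_assoc matrix_mul_lid matrix_mul_rid)
  then show "matrix_inv A $ 1 $ 1 = 1" "matrix_inv A $ 1 $ 2 = 0"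
    "matrix_inv A $ 2 $ 1 = 0" "matrix_inv A $ 2 $ 2 = 1 / x"
    by (simp_all add: B_def)
qed

text \<open>The classical -f''/f for du^2 + f^2 dv^2. The only nonzero Christoffel symbols are -f f'
  (upper index 1, lower 2 2) and f'/f (upper index 2, mixed lower indices). The metric is prescribed
  on a whole strip because the curvature differentiates it twice.\<close>

lemma gauss_curvature_polar:
  fixes f f1 f2 :: "real \<Rightarrow> real" and g :: "real^2 \<Rightarrow> real^2^2"
  assumes S: "open S" and p: "p $ 1 \<in> S"
    and g11: "\<And>q. q $ 1 \<in> S \<Longrightarrow> g q $ 1 $ 1 = 1" and g12: "\<And>q. q $ 1 \<in> S \<Longrightarrow> g q $ 1 $ 2 = 0"
    and g21: "\<And>q. q $ 1 \<in> S \<Longrightarrow> g q $ 2 $ 1 = 0"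
    and g22: "\<And>q. q $ 1 \<in> S \<Longrightarrow> g q $ 2 $ 2 = (f (q $ 1))\<^sup>2"
    and f: "\<And>u. u \<in> S \<Longrightarrow> f u \<noteq> 0" "\<And>u. u \<in> S \<Longrightarrow> (f has_real_derivative f1 u) (at u)"
      "\<And>u. u \<in> S \<Longrightarrow> (f1 has_real_derivative f2 u) (at u)"
  shows "gauss_curvature g p = - f2 (p $ 1) / f (p $ 1)"
proof -
  note c1 = pderiv_at_1_cong[OF S] and c2 = pderiv_at_2_cong[where S = S]
  have d1: "pderiv_at 1 (\<lambda>q. g q $ 1 $ 1) q = 0" "pderiv_at 1 (\<lambda>q. g q $ 1 $ 2) q = 0"
    "pderiv_at 1 (\<lambda>q. g q $ 2 $ 1) q = 0" if "q $ 1 \<in> S" for q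
    using that g11 g12 g21
    by (intro c1[where G = "\<lambda>_. 1"] c1[where G = "\<lambda>_. 0"]; simp)+
  have d1': "pderiv_at 1 (\<lambda>q. g q $ 2 $ 2) q = 2 * f (q $ 1) * f1 (q $ 1)" if "q $ 1 \<in> S" for q
    using that g22 by (intro c1[where G = "\<lambda>u. (f u)\<^sup>2"]) (auto intro!: derivative_eq_intros f(2))
  have d2: "pderiv_at 2 (\<lambda>q. g q $ 1 $ 1) q = 0" "pderiv_at 2 (\<lambda>q. g q $ 1 $ 2) q = 0"
    "pderiv_at 2 (\<lambda>q. g q $ 2 $ 1) q = 0" "pderiv_at 2 (\<lambda>q. g q $ 2 $ 2) q = 0"
    if "q $ 1 \<in> S" for q
    using that g11 g12 g21 g22 c2[of q _ "\<lambda>_. 1"] c2[of q _ "\<lambda>_. 0"] c2[of q _ "\<lambda>u. (f u)\<^sup>2"] by auto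
  have i: "matrix_inv (g q) $ 1 $ 1 = 1" "matrix_inv (g q) $ 1 $ 2 = 0"
    "matrix_inv (g q) $ 2 $ 1 = 0" "matrix_inv (g q) $ 2 $ 2 = 1 / (f (q $ 1))\<^sup>2" if "q $ 1 \<in> S" for q
    using matrix_inv_diag2[of "g q"] that g11 g12 g21 g22 f(1) by auto
  note ch = christoffel_def sum_2
  have C: "christoffel g 1 2 2 q = - f (q $ 1) * f1 (q $ 1)" "christoffel g 1 1 2 q = 0"
    "christoffel g 1 1 1 q = 0" "christoffel g 2 2 2 q = 0" "christoffel g 2 1 2 q = f1 (q $ 1) / f (q $ 1)"
    "christoffel g 1 2 1 q = 0" if "q $ 1 \<in> S" for q
    using that f(1)[OF that] by (simp_all add: ch i d1 d1' d2 power2_eq_square)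
  have "pderiv_at 1 (christoffel g 1 2 2) p = - (f1 (p $ 1) * f1 (p $ 1) + f (p $ 1) * f2 (p $ 1))"
    using C(1) by (intro c1[where G = "\<lambda>u. - f u * f1 u"] p)
      (auto intro!: derivative_eq_intros f p simp: algebra_simps)
  moreover have "pderiv_at 2 (christoffel g 1 1 2) p = 0"
    using C(2) by (intro c2[where G = "\<lambda>_. 0"] p) auto
  \<comment> \<open>The product of the two nonzero symbols contributes f'^2, which cancels the -f'^2
    from differentiating -f f'; only -f f'' remains.\<close>
  ultimately have "riemann g 1 1 2 2 p = - f (p $ 1) * f2 (p $ 1)"
    using f(1)[OF p] by (simp add: riemann_def sum_2 C[OF p])
  then show ?thesis
    using f(1)[OF p] by (simp add: gauss_curvature_def sum_2 det_2 g11[OF p] g12[OF p] g21[OF p] g22[OF p] power2_eq_square)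
qed

text \<open>Unit speed and cosh^2 - sinh^2 = 1 make the first metric coefficient 1.
  \<open>f1\<close> and \<open>f2\<close> are left open because they take two shapes: chain rule
  expressions for an unknown profile, trigonometric ones for the sphere.\<close>

lemma gauss_curvature_revolve:
  fixes k h :: "real \<Rightarrow> real"
  assumes S: "open S" and p: "p $ 1 \<in> S"
    and k: "\<And>u. u \<in> S \<Longrightarrow> (k has_real_derivative k1 u) (at u)"
    and h: "\<And>u. u \<in> S \<Longrightarrow> (h has_real_derivative h1 u) (at u)"
    and unit: "\<And>u. u \<in> S \<Longrightarrow> (k1 u)\<^sup>2 + (h1 u)\<^sup>2 = 1" and pos: "\<And>u. u \<in> S \<Longrightarrow> 0 < k u"
    and f: "\<And>u. u \<in> S \<Longrightarrow> ((\<lambda>u. sinh (k u)) has_real_derivative f1 u) (at u)"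
      "\<And>u. u \<in> S \<Longrightarrow> (f1 has_real_derivative f2 u) (at u)"
  shows "gauss_curvature (induced_metric (\<lambda>q. revolve k h (q $ 1) (q $ 2))) p = - f2 (p $ 1) / sinh (k (p $ 1))"
proof (rule gauss_curvature_polar[OF S p _ _ _ _ _ f])
  fix q :: "real^2" assume q: "q $ 1 \<in> S"
  let ?k = "k (q $ 1)" and ?v = "q $ 2" and ?k1 = "k1 (q $ 1)" and ?h1 = "h1 (q $ 1)"
  have k': "((\<lambda>t. k (q $ 1 + t)) has_real_derivative ?k1) (at 0)"
    and h': "((\<lambda>t. h (q $ 1 + t)) has_real_derivative ?h1) (at 0)"
    using DERIV_shift[of k ?k1 0 "q $ 1"] DERIV_shift[of h ?h1 0 "q $ 1"] k[OF q] h[OF q]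
    by (simp_all add: add.commute)
  have "pderiv_at 1 (\<lambda>q. revolve k h (q $ 1) (q $ 2)) q =
    (vector [sinh ?k * ?k1, cosh ?k * ?k1 * cos ?v, cosh ?k * ?k1 * sin ?v], ?h1)"
    unfolding revolve_def
    by (rule pderiv_at_eqI, simp add: axis_def, rule vector3_has_derivative)
      (auto intro!: derivative_eq_intros k' h')
  moreover have "pderiv_at 2 (\<lambda>q. revolve k h (q $ 1) (q $ 2)) q =
    (vector [0, - sinh ?k * sin ?v, sinh ?k * cos ?v], 0)"
    unfolding revolve_def
    by (rule pderiv_at_eqI, simp add: axis_def, rule vector3_has_derivative)
      (auto intro!: derivative_eq_intros)
  ultimately have e: "induced_metric (\<lambda>q. revolve k h (q $ 1) (q $ 2)) q $ 1 $ 1 =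
      - (sinh ?k * ?k1 * (sinh ?k * ?k1)) + (cosh ?k * ?k1 * cos ?v) * (cosh ?k * ?k1 * cos ?v)
       + (cosh ?k * ?k1 * sin ?v) * (cosh ?k * ?k1 * sin ?v) + ?h1 * ?h1"
    "induced_metric (\<lambda>q. revolve k h (q $ 1) (q $ 2)) q $ 1 $ 2 =
      - (sinh ?k * ?k1 * 0) + cosh ?k * ?k1 * cos ?v * (- sinh ?k * sin ?v) + cosh ?k * ?k1 * sin ?v * (sinh ?k * cos ?v) + ?h1 * 0"
    "induced_metric (\<lambda>q. revolve k h (q $ 1) (q $ 2)) q $ 2 $ 1 =
      - (0 * (sinh ?k * ?k1)) + (- sinh ?k * sin ?v) * (cosh ?k * ?k1 * cos ?v) + (sinh ?k * cos ?v) * (cosh ?k * ?k1 * sin ?v) + 0 * ?h1"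
    "induced_metric (\<lambda>q. revolve k h (q $ 1) (q $ 2)) q $ 2 $ 2 =
      - (0 * 0) + (- sinh ?k * sin ?v) * (- sinh ?k * sin ?v) + (sinh ?k * cos ?v) * (sinh ?k * cos ?v) + 0 * 0"
    by (simp_all only: induced_metric_def vec_lambda_beta ambient_form_simps)
  have cs: "cos ?v * cos ?v = 1 - sin ?v * sin ?v" "cosh ?k * cosh ?k = 1 + sinh ?k * sinh ?k"
    using sin_cos_squared_add[of ?v] cosh_square_eq[of ?k]
    by (simp_all add: power2_eq_square eq_diff_eq add.commute del: sin_cos_squared_add3)
  show "induced_metric (\<lambda>q. revolve k h (q $ 1) (q $ 2)) q $ 1 $ 1 = 1"
    unfolding e using unit[OF q] cs unfolding power2_eq_square by algebra
  show "induced_metric (\<lambda>q. revolve k h (q $ 1) (q $ 2)) q $ 1 $ 2 = 0"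
    "induced_metric (\<lambda>q. revolve k h (q $ 1) (q $ 2)) q $ 2 $ 1 = 0"
    unfolding e by simp_all
  show "induced_metric (\<lambda>q. revolve k h (q $ 1) (q $ 2)) q $ 2 $ 2 = (sinh (k (q $ 1)))\<^sup>2"
    unfolding e using cs(1) unfolding power2_eq_square by algebra
qed (use pos in \<open>auto simp: less_imp_neq[symmetric]\<close>)

section \<open>Lengths of curves\<close>

text \<open>Tangent vectors of the hyperboloid are spacelike: tangency and Cauchy-Schwarz give q^2 +
  r^2 \<le> a^2 (q^2 + r^2 - p^2), so every component is at most \<open>a\<close>, the first
  coordinate of the base point, times the length.\<close>

lemma hyperboloid_tangent_bounds:
  fixes x w :: "(real^3) \<times> real"
  assumes x: "x \<in> H2xR" and w: "- (fst x $ 1 * fst w $ 1) + fst x $ 2 * fst w $ 2 + fst x $ 3 * fst w $ 3 = 0"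
  shows "\<bar>snd w\<bar> \<le> sqrt (ambient_form w w)"
    and "\<And>i. \<bar>fst w $ i\<bar> \<le> fst x $ 1 * sqrt (ambient_form w w)"
proof -
  define a b c p q r where "a = fst x $ 1" "b = fst x $ 2" "c = fst x $ 3"
    "p = fst w $ 1" "q = fst w $ 2" "r = fst w $ 3"
  note d = this
  have a: "a > 0" "a\<^sup>2 = 1 + b\<^sup>2 + c\<^sup>2"
    using x by (auto simp: H2xR_def hyperboloid_def d)
  define Q where "Q = - p\<^sup>2 + q\<^sup>2 + r\<^sup>2"
  have form: "ambient_form w w = Q + (snd w)\<^sup>2"
    by (simp add: ambient_form_def Q_def d power2_eq_square)
  have apq: "a * p = b * q + c * r" using w by (simp add: d)
  \<comment> \<open>Lagrange's identity, which yields the Cauchy-Schwarz bound for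
    \<open>b * q + c * r\<close>.\<close>
  have "(b * q + c * r)\<^sup>2 + (b * r - c * q)\<^sup>2 = (b\<^sup>2 + c\<^sup>2) * (q\<^sup>2 + r\<^sup>2)"
    by (simp add: power2_eq_square algebra_simps)
  then have "(a * p)\<^sup>2 \<le> (b\<^sup>2 + c\<^sup>2) * (q\<^sup>2 + r\<^sup>2)"
    unfolding apq by (metis le_add_same_cancel1 zero_le_power2)
  then have cs: "a\<^sup>2 * p\<^sup>2 \<le> (a\<^sup>2 - 1) * (q\<^sup>2 + r\<^sup>2)"
    by (simp add: a power_mult_distrib)
  then have qr: "q\<^sup>2 + r\<^sup>2 \<le> a\<^sup>2 * Q"
    by (simp add: Q_def algebra_simps)
  have "a\<^sup>2 * p\<^sup>2 \<le> a\<^sup>2 * (q\<^sup>2 + r\<^sup>2)"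
    using cs by (simp add: algebra_simps) (smt (verit) zero_le_power2)
  then have p: "p\<^sup>2 \<le> q\<^sup>2 + r\<^sup>2" using a(1) by simp
  have "0 \<le> a\<^sup>2 * Q" using qr by (smt (verit) zero_le_power2)
  then have Q: "0 \<le> Q" using a(1) by (simp add: zero_le_mult_iff)
  show "\<bar>snd w\<bar> \<le> sqrt (ambient_form w w)"
    using Q by (intro real_le_rsqrt) (simp add: form)
  fix i :: 3
  have "(fst w $ i)\<^sup>2 \<le> q\<^sup>2 + r\<^sup>2"
    using exhaust_3[of i] p by (auto simp: d)
  also have "\<dots> \<le> a\<^sup>2 * ambient_form w w"
    using qr a(1) by (simp add: form algebra_simps add_increasing2)
  finally have "\<bar>fst w $ i\<bar> \<le> sqrt (a\<^sup>2 * ambient_form w w)"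
    by (intro real_le_rsqrt) simp
  then show "\<bar>fst w $ i\<bar> \<le> fst x $ 1 * sqrt (ambient_form w w)"
    using a(1) by (simp add: real_sqrt_mult d)
qed

lemma vector_derivative_tangent:
  fixes c :: "real \<Rightarrow> (real^3) \<times> real"
  assumes c: "(c has_vector_derivative w) (at t)" and "open U" "t \<in> U" and H: "\<And>s. s \<in> U \<Longrightarrow> c s \<in> H2xR"
  shows "- (fst (c t) $ 1 * fst w $ 1) + fst (c t) $ 2 * fst w $ 2 + fst (c t) $ 3 * fst w $ 3 = 0"
proof -
  have d: "((\<lambda>s. fst (c s) $ i) has_real_derivative fst w $ i) (at t)" for i
    using bounded_linear.has_vector_derivative[OF bounded_linear_compose[OF bounded_linear_vec_nth bounded_linear_fst] c]
    by (simp add: has_real_derivative_iff_has_vector_derivative)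
  have "((\<lambda>s. - (fst (c s) $ 1)\<^sup>2 + (fst (c s) $ 2)\<^sup>2 + (fst (c s) $ 3)\<^sup>2) has_real_derivative
     2 * (- (fst (c t) $ 1 * fst w $ 1) + fst (c t) $ 2 * fst w $ 2 + fst (c t) $ 3 * fst w $ 3)) (at t)"
    by (auto intro!: derivative_eq_intros d)
  moreover have "((\<lambda>s. - (fst (c s) $ 1)\<^sup>2 + (fst (c s) $ 2)\<^sup>2 + (fst (c s) $ 3)\<^sup>2) has_real_derivative 0) (at t)"
    by (rule DERIV_cong_ev[THEN iffD2, OF refl _ refl DERIV_const[of "-1"]])
      (use assms in \<open>auto simp: eventually_nhds H2xR_def hyperboloid_def mem_Times_iff intro!: exI[of _ U]\<close>)
  ultimately show ?thesis using DERIV_unique by fastforce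
qed

text \<open>Integrating the derivative of \<open>G\<close> along the curve bounds its variation by
  the length. Arbitrary times \<open>s\<close>, \<open>t\<close> make it applicable to points passed
  on the way; \<open>X\<close> admits differentials that are bounded only on part of
  \<open>H2xR\<close>.\<close>

lemma curve_length_lower_bound:
  fixes f :: "'a::topological_space \<Rightarrow> (real^3) \<times> real" and G :: "(real^3) \<times> real \<Rightarrow> real"
  assumes \<gamma>: "\<gamma> \<in> curves_between M f a b" and X: "f ` M \<subseteq> X" "X \<subseteq> H2xR"
    and G: "\<And>x. x \<in> X \<Longrightarrow> (G has_derivative G' x) (at x)"
    and le: "\<And>x w. x \<in> X \<Longrightarrow> - (fst x $ 1 * fst w $ 1) + fst x $ 2 * fst w $ 2 + fst x $ 3 * fst w $ 3 = 0
      \<Longrightarrow> \<bar>G' x w\<bar> \<le> sqrt (ambient_form w w)"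
    and st: "s \<in> {0..1}" "t \<in> {0..1}"
  shows "\<bar>G (f (\<gamma> t)) - G (f (\<gamma> s))\<bar> \<le> curve_length f \<gamma>"
proof -
  have vp: "valid_path (f \<circ> \<gamma>)" and si: "speed f \<gamma> integrable_on {0..1}" and im: "path_image \<gamma> \<subseteq> M"
    using \<gamma> by (auto simp: curves_between_def)
  have inX: "(f \<circ> \<gamma>) \<tau> \<in> X" if "\<tau> \<in> {0..1}" for \<tau>
    using im that X(1) by (auto simp: path_image_def image_subset_iff)
  obtain S where S: "finite S" "(f \<circ> \<gamma>) C1_differentiable_on {0..1} - S"
    and cont: "continuous_on {0..1} (f \<circ> \<gamma>)"
    using vp by (auto simp: valid_path_def piecewise_C1_differentiable_on_def)
  \<comment> \<open>The end times join the exceptional set so that each remaining time has an open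
    neighbourhood on which the curve is known to lie in \<open>H2xR\<close>, as tangency
    requires.\<close>
  define T where "T = S \<union> {0, 1}"
  have T: "finite T" by (simp add: T_def S)
  define D where "D \<tau> = vector_derivative (f \<circ> \<gamma>) (at \<tau>)" for \<tau>
  have D: "((f \<circ> \<gamma>) has_vector_derivative D \<tau>) (at \<tau>)" if "\<tau> \<in> {0..1} - T" for \<tau>
    using that S(2) by (auto simp: D_def T_def C1_differentiable_on_eq vector_derivative_works)
  have tan: "- (fst ((f \<circ> \<gamma>) \<tau>) $ 1 * fst (D \<tau>) $ 1) + fst ((f \<circ> \<gamma>) \<tau>) $ 2 * fst (D \<tau>) $ 2
      + fst ((f \<circ> \<gamma>) \<tau>) $ 3 * fst (D \<tau>) $ 3 = 0" if "\<tau> \<in> {0..1} - T" for \<tau>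
    by (rule vector_derivative_tangent[OF D[OF that], of "{0<..<1}"])
      (use that inX X(2) in \<open>auto simp: T_def\<close>)
  \<comment> \<open>Zero at the finitely many exceptional times, where the derivative carries no
    information; the integrals do not change.\<close>
  define p where "p \<tau> = (if \<tau> \<in> T then 0 else speed f \<gamma> \<tau>)" for \<tau>
  define e where "e \<tau> = (if \<tau> \<in> T then 0 else G' ((f \<circ> \<gamma>) \<tau>) (D \<tau>))" for \<tau>
  have pint: "p integrable_on {0..1}"
    by (rule integrable_spike_finite[OF T _ si]) (simp add: p_def)
  have len: "integral {0..1} p = curve_length f \<gamma>"
    unfolding curve_length_def
    by (rule integral_spike[OF negligible_finite[OF T]]) (simp add: p_def)
  have ep: "norm (e \<tau>) \<le> p \<tau>" if "\<tau> \<in> {0..1}" for \<tau>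
    using le[OF inX tan, of \<tau>] that by (auto simp: e_def p_def speed_def D_def Let_def)
  have cG: "continuous_on X G"
    using G by (auto intro!: continuous_at_imp_continuous_on has_derivative_continuous)
  have *: "\<bar>G (f (\<gamma> t)) - G (f (\<gamma> s))\<bar> \<le> curve_length f \<gamma>" if st: "s \<in> {0..1}" "t \<in> {0..1}" "s \<le> t" for s t
  proof -
    have sub: "{s..t} \<subseteq> {0..1}" using st by auto
    have "((\<lambda>\<tau>. G ((f \<circ> \<gamma>) \<tau>)) has_vector_derivative e \<tau>) (at \<tau>)" if "\<tau> \<in> {s..t} - T" for \<tau>
    proof -
      have \<tau>: "\<tau> \<in> {0..1} - T" using that sub by auto
      show ?thesis
        using vector_derivative_diff_chain_within[of "f \<circ> \<gamma>" "D \<tau>" \<tau> UNIV G "G' ((f \<circ> \<gamma>) \<tau>)"]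
          has_derivative_at_withinI[OF G[OF inX]] D[OF \<tau>] \<tau> by (simp add: e_def o_def)
    qed
    moreover have "continuous_on {s..t} (\<lambda>\<tau>. G ((f \<circ> \<gamma>) \<tau>))"
      using cG continuous_on_subset[OF cont sub] inX sub by (auto intro: continuous_on_compose2)
    ultimately have i: "(e has_integral (G ((f \<circ> \<gamma>) t) - G ((f \<circ> \<gamma>) s))) {s..t}"
      using fundamental_theorem_of_calculus_strong[OF T st(3)] by blast
    have pst: "p integrable_on {s..t}"
      using integrable_on_subinterval[OF pint sub] .
    have "norm (integral {s..t} e) \<le> integral {s..t} p"
      using sub by (intro integral_norm_bound_integral pst ep) (use i in \<open>auto simp: integrable_on_def\<close>)
    also have "\<dots> \<le> integral {0..1} p"
      using ep by (intro integral_subset_le sub pst pint) (smt (verit) norm_ge_zero)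
    finally show ?thesis using i len by (simp add: integral_unique)
  qed
  show ?thesis
    using *[OF st] *[OF st(2,1)] by linarith
qed

lemma curve_length_ge_height:
  fixes f :: "'a::topological_space \<Rightarrow> (real^3) \<times> real"
  assumes "\<gamma> \<in> curves_between M f a b" "f ` M \<subseteq> H2xR" "s \<in> {0..1}" "t \<in> {0..1}"
  shows "\<bar>snd (f (\<gamma> t)) - snd (f (\<gamma> s))\<bar> \<le> curve_length f \<gamma>"
  by (rule curve_length_lower_bound[OF assms(1,2) order_refl bounded_linear_imp_has_derivative[OF bounded_linear_snd] _ assms(3,4)])
    (rule hyperboloid_tangent_bounds(1))

lemma curve_length_nonneg:
  assumes "\<gamma> \<in> curves_between M f a b" "f ` M \<subseteq> H2xR"
  shows "0 \<le> curve_length f \<gamma>"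
  using curve_length_ge_height[OF assms, of 0 0] by simp

text \<open>The differential sends w to w1 / x1, and |w1| \<le> x1 |w| for tangent w. Unlike the
  coordinates, this logarithm is 1-Lipschitz on all of \<open>H2xR\<close>, so it serves profiles
  with unbounded \<open>k\<close>.\<close>

lemma curve_length_ge_ln:
  fixes f :: "'a::topological_space \<Rightarrow> (real^3) \<times> real"
  assumes "\<gamma> \<in> curves_between M f a b" "f ` M \<subseteq> H2xR" "s \<in> {0..1}" "t \<in> {0..1}"
  shows "\<bar>ln (fst (f (\<gamma> t)) $ 1) - ln (fst (f (\<gamma> s)) $ 1)\<bar> \<le> curve_length f \<gamma>"
proof (rule curve_length_lower_bound[OF assms(1,2) order_refl _ _ assms(3,4), where G = "\<lambda>x. ln (fst x $ 1)"])
  fix x :: "(real^3) \<times> real" assume x: "x \<in> H2xR"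
  then have pos: "fst x $ 1 > 0" by (auto simp: H2xR_def hyperboloid_def)
  have "((\<lambda>x::(real^3) \<times> real. fst x $ 1) has_derivative (\<lambda>w. fst w $ 1)) (at x)"
    by (rule bounded_linear_imp_has_derivative
        [OF bounded_linear_compose[OF bounded_linear_vec_nth bounded_linear_fst]])
  from has_derivative_ln[OF pos this]
  show "((\<lambda>x. ln (fst x $ 1)) has_derivative (\<lambda>w. fst w $ 1 * inverse (fst x $ 1))) (at x)" .
  fix w :: "(real^3) \<times> real"
  assume "- (fst x $ 1 * fst w $ 1) + fst x $ 2 * fst w $ 2 + fst x $ 3 * fst w $ 3 = 0"
  from hyperboloid_tangent_bounds(2)[OF x this, of 1] pos
  show "\<bar>fst w $ 1 * inverse (fst x $ 1)\<bar> \<le> sqrt (ambient_form w w)"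
    by (simp add: field_simps)
qed

text \<open>Division by a bound for the first coordinate makes every coordinate 1-Lipschitz; in
  contrast to the logarithm, this also detects the angle.\<close>

lemma curve_length_ge_coord:
  fixes f :: "'a::topological_space \<Rightarrow> (real^3) \<times> real"
  assumes "\<gamma> \<in> curves_between M f a b" "f ` M \<subseteq> H2xR" "s \<in> {0..1}" "t \<in> {0..1}"
    and C: "C > 0" "\<And>x. x \<in> M \<Longrightarrow> fst (f x) $ 1 \<le> C"
  shows "\<bar>fst (f (\<gamma> t)) $ i - fst (f (\<gamma> s)) $ i\<bar> \<le> C * curve_length f \<gamma>"
proof -
  have "\<bar>fst (f (\<gamma> t)) $ i / C - fst (f (\<gamma> s)) $ i / C\<bar> \<le> curve_length f \<gamma>"
  proof (rule curve_length_lower_bound[OF assms(1) _ _ _ _ assms(3,4), where G = "\<lambda>x. fst x $ i / C"])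
    let ?X = "{x \<in> H2xR. fst x $ 1 \<le> C}"
    show "f ` M \<subseteq> ?X" "?X \<subseteq> H2xR" using assms(2) C(2) by auto
    show "((\<lambda>x. fst x $ i / C) has_derivative (\<lambda>w. fst w $ i / C)) (at x)" for x :: "(real^3) \<times> real"
      by (rule bounded_linear_imp_has_derivative[OF bounded_linear_compose[OF bounded_linear_divide
          bounded_linear_compose[OF bounded_linear_vec_nth bounded_linear_fst]]])
    fix x w :: "(real^3) \<times> real" assume x: "x \<in> ?X"
      and "- (fst x $ 1 * fst w $ 1) + fst x $ 2 * fst w $ 2 + fst x $ 3 * fst w $ 3 = 0"
    then have "\<bar>fst w $ i\<bar> \<le> fst x $ 1 * sqrt (ambient_form w w)" "\<bar>snd w\<bar> \<le> sqrt (ambient_form w w)"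
      using hyperboloid_tangent_bounds[of x w] by auto
    then have "\<bar>fst w $ i\<bar> \<le> C * sqrt (ambient_form w w)"
      using x by (smt (verit) mem_Collect_eq mult_right_mono abs_ge_zero)
    then show "\<bar>fst w $ i / C\<bar> \<le> sqrt (ambient_form w w)"
      using C(1) by (simp add: field_simps)
  qed
  then show ?thesis using C(1) by (simp add: field_simps abs_if split: if_splits)
qed

lemma riem_dist_le:
  assumes "\<gamma> \<in> curves_between M f a b" "f ` M \<subseteq> H2xR"
  shows "riem_dist M f a b \<le> curve_length f \<gamma>"
  unfolding riem_dist_def
  using curve_length_nonneg assms by (intro cINF_lower bdd_belowI2[where m = 0]) blast+

text \<open>The infimum of the empty set of reals is an unspecified value, hence the nonemptiness
  condition.\<close>

lemma riem_dist_ge: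
  assumes "curves_between M f a b \<noteq> {}" "\<And>\<gamma>. \<gamma> \<in> curves_between M f a b \<Longrightarrow> d \<le> curve_length f \<gamma>"
  shows "d \<le> riem_dist M f a b"
  unfolding riem_dist_def using assms by (intro cINF_greatest) auto

section \<open>Profiles and polar paths\<close>

lemma continuous_on_vector3:
  fixes a b c :: "'a::topological_space \<Rightarrow> real"
  assumes "continuous_on S a" "continuous_on S b" "continuous_on S c"
  shows "continuous_on S (\<lambda>t. vector [a t, b t, c t] :: real^3)"
proof -
  have "continuous_on S (\<lambda>t. (vector [a t, b t, c t] :: real^3) $ i)" for i
    using exhaust_3[of i] assms by auto
  then have "continuous_on S (\<lambda>t. \<chi> i. (vector [a t, b t, c t] :: real^3) $ i)"
    by (rule continuous_on_vec_lambda)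
  then show ?thesis by simp
qed

context
  fixes I :: "real set" and k h :: "real \<Rightarrow> real"
  assumes rs: "revolution_surface I k h"
begin

lemma profile_interval: "is_interval I" "interior I \<noteq> {}" "open (interior I)" "is_interval (interior I)"
  using rs by (auto simp: revolution_surface_def is_interval_convex_1)

lemma profile_pos: "u \<in> interior I \<Longrightarrow> 0 < k u"
  and profile_pole: "a \<in> I - interior I \<Longrightarrow> k a = 0" "a \<in> I - interior I \<Longrightarrow> smooth_pole I k h a"
  and profile_unit: "u \<in> interior I \<Longrightarrow> (deriv k u)\<^sup>2 + (deriv h u)\<^sup>2 = 1"
  using rs by (auto simp: revolution_surface_def)

lemma profile_nonneg: "u \<in> I \<Longrightarrow> 0 \<le> k u"
  using profile_pos[of u] profile_pole(1)[of u] by fastforce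

lemma profile_smooth: "Ck_on n k (interior I)" "Ck_on n h (interior I)"
  using rs by (auto simp: revolution_surface_def Cinf_on_def)

lemma profile_derivatives:
  assumes "u \<in> interior I"
  shows "(k has_real_derivative deriv k u) (at u)" "(h has_real_derivative deriv h u) (at u)"
    "(deriv k has_real_derivative deriv (deriv k) u) (at u)"
proof -
  note d = Ck_on_imp_deriv[OF profile_interval(3)]
  show "(k has_real_derivative deriv k u) (at u)" "(h has_real_derivative deriv h u) (at u)"
    using d(1)[OF profile_smooth(1) assms] d(1)[OF profile_smooth(2) assms] by auto
  show "(deriv k has_real_derivative deriv (deriv k) u) (at u)"
    using d(1)[OF d(2)[OF profile_smooth(1)] assms] .
qed

lemma profile_deriv_continuous:
  "continuous_on (interior I) (deriv k)" "continuous_on (interior I) (deriv h)"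
  using Ck_on_imp_deriv(2)[OF profile_interval(3) profile_smooth(1), of 0]
    Ck_on_imp_deriv(2)[OF profile_interval(3) profile_smooth(2), of 0] by simp_all

lemma profile_segment: "u \<in> I \<Longrightarrow> v \<in> I \<Longrightarrow> closed_segment u v \<subseteq> I"
  using profile_interval(1) by (simp add: is_interval_convex_1 closed_segment_subset)

lemma profile_between:
  assumes "u \<in> I" "v \<in> I" "u < t" "t < v"
  shows "t \<in> interior I"
proof -
  have "{u<..<v} \<subseteq> I"
    using profile_interval(1) assms(1,2) unfolding is_interval_1
    by (meson greaterThanLessThan_iff less_imp_le subsetI)
  then show ?thesis using assms(3,4) by (meson greaterThanLessThan_iff interiorI open_greaterThanLessThan)
qed

text \<open>At an end point \<open>h\<close> is continuous because it has a derivative within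
  \<open>I\<close>. For \<open>k\<close> the pole patch is restricted to real arguments, where its
  first coordinate is the hyperbolic cosine of \<open>k\<close>, which determines \<open>k\<close>
  by nonnegativity.\<close>

lemma profile_continuous: "continuous_on I k" "continuous_on I h"
proof -
  have "continuous (at a within I) k \<and> continuous (at a within I) h" if a: "a \<in> I" for a
  proof (cases "a \<in> interior I")
    case True
    then show ?thesis
      using profile_derivatives(1,2)[OF True] DERIV_isCont continuous_at_imp_continuous_at_within by blast
  next
    case False
    then have pole: "smooth_pole I k h a" and k0: "k a = 0" using a profile_pole by auto
    from pole obtain s r where s: "s \<in> {-1, 1}" and r: "r > 0" and sI: "\<forall>t\<in>{0..<r}. a + s * t \<in> I"
      and C: "Cinf_on (\<lambda>w::complex. revolve k h (a + s * norm w) (Arg w)) (ball 0 r)"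
      unfolding smooth_pole_def by blast
    define F where "F = (\<lambda>w::complex. revolve k h (a + s * norm w) (Arg w))"
    have "continuous_on (ball 0 r) F" using C unfolding Cinf_on_def F_def by (metis Ck_on.simps(1))
    then have "isCont F 0" using r by (simp add: continuous_on_eq_continuous_at)
    note lim = isCont_tendsto_compose[OF this]
    have "((\<lambda>u. complex_of_real (u - a)) \<longlongrightarrow> complex_of_real (a - a)) (at a within I)"
      by (intro tendsto_intros)
    then have "((\<lambda>u. F (of_real (u - a))) \<longlongrightarrow> F 0) (at a within I)"
      using lim by simp
    then have "((\<lambda>u. fst (F (of_real (u - a))) $ 1) \<longlongrightarrow> fst (F 0) $ 1) (at a within I)"
      by (intro tendsto_intros)
    then have l: "((\<lambda>u. cosh (k (a + s * \<bar>u - a\<bar>))) \<longlongrightarrow> 1) (at a within I)"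
      unfolding F_def revolve_def norm_of_real by (simp add: k0)
    \<comment> \<open>\<open>I\<close> lies on the side of \<open>a\<close> to which
      \<open>s\<close> points: a point of \<open>I\<close> on the other side would make
      \<open>a\<close> interior.\<close>
    have side: "a + s * \<bar>u - a\<bar> = u" if u: "u \<in> I" for u
    proof (rule ccontr)
      assume ne: "a + s * \<bar>u - a\<bar> \<noteq> u"
      have "a + s * (r / 2) \<in> I" using r bspec[OF sI, of "r / 2"] by simp
      then have "a \<in> interior I"
        using s r ne u profile_between[of u "a + s * (r/2)" a] profile_between[of "a + s * (r/2)" u a]
        by (auto simp: abs_if split: if_splits)
      with False show False ..
    qed
    have "((\<lambda>u. cosh (k u)) \<longlongrightarrow> 1) (at a within I)"
      by (rule Lim_transform_eventually[OF l]) (auto simp: eventually_at_filter side)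
    \<comment> \<open>\<open>arsinh (sqrt (x^2 - 1))\<close> inverts \<open>cosh\<close> on
      nonnegative numbers and is continuous at the limit value 1.\<close>
    then have "((\<lambda>u. arsinh (sqrt ((cosh (k u))\<^sup>2 - 1))) \<longlongrightarrow> arsinh (sqrt (1\<^sup>2 - 1))) (at a within I)"
      by (intro tendsto_intros)
    moreover have "arsinh (sqrt ((cosh (k u))\<^sup>2 - 1)) = k u" if "u \<in> I" for u
      using profile_nonneg[OF that] by (simp add: cosh_square_eq arsinh_sinh_real)
    then have "eventually (\<lambda>u. arsinh (sqrt ((cosh (k u))\<^sup>2 - 1)) = k u) (at a within I)"
      by (auto simp: eventually_at_filter)
    ultimately have "(k \<longlongrightarrow> arsinh (sqrt (1\<^sup>2 - 1))) (at a within I)"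
      by (rule Lim_transform_eventually)
    then have "(k \<longlongrightarrow> 0) (at a within I)" by simp
    moreover have "continuous (at a within I) h"
      using pole DERIV_continuous by (auto simp: smooth_pole_def)
    ultimately show ?thesis using k0 by (simp add: continuous_within)
  qed
  then show "continuous_on I k" "continuous_on I h"
    by (auto simp: continuous_on_eq_continuous_within)
qed

lemma rev_immersion_in_H2xR: "rev_immersion k h ` rev_surface I k \<subseteq> H2xR"
proof -
  have "(sinh x * cos v)\<^sup>2 - (cosh x)\<^sup>2 + (sinh x * sin v)\<^sup>2 = - 1" for x v :: real
    using sin_cos_squared_add[of v] unfolding cosh_square_eq power_mult_distrib by algebra
  then show ?thesis
    by (auto simp: rev_immersion_def rev_surface_def H2xR_def hyperboloid_def)
qed

text \<open>The curve is a straight segment in \<open>(u, v)\<close>; its speed is the square root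
  of (u1 - u0)^2 + sinh^2 k (v1 - v0)^2, at most the sum of the two absolute values. Bounding the
  product by \<open>B\<close> permits \<open>B = 0\<close> along meridians.\<close>

lemma polar_path:
  assumes u: "u0 \<in> I" "u1 \<in> I" and B: "\<And>u. u \<in> closed_segment u0 u1 \<Longrightarrow> sinh (k u) * \<bar>v1 - v0\<bar> \<le> B"
  obtains \<gamma> where "\<gamma> \<in> curves_between (rev_surface I k) (rev_immersion k h)
      (u0, sinh (k u0) * cos v0, sinh (k u0) * sin v0) (u1, sinh (k u1) * cos v1, sinh (k u1) * sin v1)"
    and "curve_length (rev_immersion k h) \<gamma> \<le> \<bar>u1 - u0\<bar> + B"
proof -
  define U where "U t = u0 + t * (u1 - u0)" for t
  define V where "V t = v0 + t * (v1 - v0)" for t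
  define \<gamma> where "\<gamma> t = (U t, sinh (k (U t)) * cos (V t), sinh (k (U t)) * sin (V t))" for t
  let ?f = "rev_immersion k h"
  have cU: "continuous_on S U" and cV: "continuous_on S V" for S
    unfolding U_def V_def by (intro continuous_intros)+
  have Useg: "U t \<in> closed_segment u0 u1" if "t \<in> {0..1}" for t
    using that by (auto simp: closed_segment_def U_def algebra_simps intro!: exI[of _ t])
  then have UI: "U t \<in> I" if "t \<in> {0..1}" for t
    using profile_segment[OF u] that by blast
  \<comment> \<open>Strictly between the end times the curve avoids the poles, where no two-sided
    derivative of the profile is available, unless it rests at one.\<close>
  have Uint: "U t \<in> interior I \<or> (\<forall>t. U t = u0) \<and> k u0 = 0 \<and> u1 = u0" if t: "t \<in> {0<..<1}" for t
  proof (cases "u0 = u1")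
    case True
    then show ?thesis using u profile_pole(1)[of u0] by (auto simp: U_def)
  next
    case False
    have "u0 < U t \<and> U t < u1 \<or> u1 < U t \<and> U t < u0"
    proof (cases "u0 < u1")
      case True
      then have "0 < t * (u1 - u0)" "t * (u1 - u0) < 1 * (u1 - u0)"
        using t by (auto intro!: mult_strict_right_mono)
      then show ?thesis by (simp add: U_def)
    next
      case False
      then have "0 < t * (u0 - u1)" "t * (u0 - u1) < 1 * (u0 - u1)"
        using t \<open>u0 \<noteq> u1\<close> by (auto intro!: mult_strict_right_mono)
      then show ?thesis by (simp add: U_def algebra_simps)
    qed
    then show ?thesis using profile_between u by blast
  qed
  have ck: "continuous_on {0..1} (\<lambda>t. k (U t))" "continuous_on {0..1} (\<lambda>t. h (U t))"
    using UI by (auto intro!: continuous_on_compose2[OF profile_continuous(1) cU]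
        continuous_on_compose2[OF profile_continuous(2) cU])
  define D where "D t = (if k u0 = 0 \<and> u1 = u0 then 0 else
    (vector [sinh (k (U t)) * (deriv k (U t) * (u1 - u0)),
      cosh (k (U t)) * (deriv k (U t) * (u1 - u0)) * cos (V t) - sinh (k (U t)) * (sin (V t) * (v1 - v0)),
      cosh (k (U t)) * (deriv k (U t) * (u1 - u0)) * sin (V t) + sinh (k (U t)) * (cos (V t) * (v1 - v0))] :: real^3,
     deriv h (U t) * (u1 - u0)))" for t
  define \<sigma> where "\<sigma> t = sqrt ((u1 - u0)\<^sup>2 + (sinh (k (U t)))\<^sup>2 * (v1 - v0)\<^sup>2)" for t
  have fg: "(?f \<circ> \<gamma>) t = (vector [cosh (k (U t)), sinh (k (U t)) * cos (V t), sinh (k (U t)) * sin (V t)], h (U t))" for t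
    by (simp add: \<gamma>_def rev_immersion_def)
  have D: "((?f \<circ> \<gamma>) has_vector_derivative D t) (at t)" and Dform: "sqrt (ambient_form (D t) (D t)) = \<sigma> t"
    if t: "t \<in> {0<..<1}" for t
  proof -
    have "((?f \<circ> \<gamma>) has_vector_derivative D t) (at t) \<and> ambient_form (D t) (D t) = (\<sigma> t)\<^sup>2"
    proof (cases "k u0 = 0 \<and> u1 = u0")
      case True
      then have "U t = u0" for t by (simp add: U_def)
      then have "(?f \<circ> \<gamma>) = (\<lambda>t. (vector [1, 0, 0], h u0))"
        unfolding fg[abs_def] fun_eq_iff using True by (simp add: fg)
      then show ?thesis
        using True \<open>\<And>t. U t = u0\<close> by (simp add: D_def \<sigma>_def ambient_form_def)
    next
      case False
      then have Ui: "U t \<in> interior I" using Uint[OF t] by auto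
      have dU: "(U has_real_derivative (u1 - u0)) (at t)" and dV: "(V has_real_derivative (v1 - v0)) (at t)"
        unfolding U_def V_def by (auto intro!: derivative_eq_intros)
      have dk: "((\<lambda>t. k (U t)) has_real_derivative deriv k (U t) * (u1 - u0)) (at t)"
        and dh: "((\<lambda>t. h (U t)) has_real_derivative deriv h (U t) * (u1 - u0)) (at t)"
        using DERIV_chain2[OF profile_derivatives(1)[OF Ui] dU] DERIV_chain2[OF profile_derivatives(2)[OF Ui] dU] .
      have fg': "?f \<circ> \<gamma> = (\<lambda>t. (vector [cosh (k (U t)), sinh (k (U t)) * cos (V t), sinh (k (U t)) * sin (V t)], h (U t)))"
        using fg by (rule ext)
      have "((?f \<circ> \<gamma>) has_vector_derivative D t) (at t)"
        unfolding fg' D_def if_not_P[OF False]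
        by (rule vector3_has_derivative) (auto intro!: derivative_eq_intros dk dh dV)
      moreover have "ambient_form (D t) (D t) = (\<sigma> t)\<^sup>2"
      proof -
        define s c C S p q w where "s = sinh (k (U t))" "c = cosh (k (U t))" "C = cos (V t)" "S = sin (V t)"
          "p = deriv k (U t) * (u1 - u0)" "q = deriv h (U t) * (u1 - u0)" "w = v1 - v0"
        note abb = this
        have CS: "C * C + S * S = 1" and cs: "c * c = s * s + 1"
          using cosh_square_eq[of "k (U t)"] by (simp_all add: abb power2_eq_square)
        have "p * p + q * q = ((deriv k (U t))\<^sup>2 + (deriv h (U t))\<^sup>2) * ((u1 - u0) * (u1 - u0))"
          by (simp add: abb power2_eq_square algebra_simps)
        then have pq: "p * p + q * q = (u1 - u0) * (u1 - u0)"
          using profile_unit[OF Ui] by simp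
        have "ambient_form (D t) (D t) = - (s * p * (s * p)) + (c * p * C - s * (S * w)) * (c * p * C - s * (S * w))
          + (c * p * S + s * (C * w)) * (c * p * S + s * (C * w)) + q * q"
          by (simp add: D_def if_not_P[OF False] ambient_form_simps abb)
        also have "\<dots> = p * p + q * q + s * s * (w * w)"
          using CS cs by algebra
        also have "\<dots> = (\<sigma> t)\<^sup>2"
          unfolding \<sigma>_def pq by (simp add: abb power2_eq_square)
        finally show ?thesis .
      qed
      ultimately show ?thesis ..
    qed
    then show "((?f \<circ> \<gamma>) has_vector_derivative D t) (at t)" "sqrt (ambient_form (D t) (D t)) = \<sigma> t"
      by (auto simp: \<sigma>_def)
  qed
  have "continuous_on {0<..<1} D"
  proof (cases "k u0 = 0 \<and> u1 = u0")
    case True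
    then show ?thesis by (simp add: D_def[abs_def])
  next
    case False
    then have "U ` {0<..<1} \<subseteq> interior I" using Uint by blast
    then have "continuous_on {0<..<1} (\<lambda>t. deriv k (U t))" "continuous_on {0<..<1} (\<lambda>t. deriv h (U t))"
      using continuous_on_compose2[OF profile_deriv_continuous(1) cU] continuous_on_compose2[OF profile_deriv_continuous(2) cU] by auto
    then show ?thesis
      unfolding D_def if_not_P[OF False]
      by (intro continuous_on_Pair continuous_on_vector3 continuous_intros cU cV continuous_on_subset[OF ck(1)]) auto
  qed
  \<comment> \<open>Times 0 and 1 are exempted since the segment may start or end at a pole.\<close>
  then have C1: "(?f \<circ> \<gamma>) C1_differentiable_on {0..1} - {0, 1}"
    unfolding C1_differentiable_on_def using D by (intro exI[of _ D]) (auto simp: atLeastAtMost_diff_ends)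
  have c\<gamma>: "continuous_on {0..1} \<gamma>"
    unfolding \<gamma>_def by (intro continuous_on_Pair continuous_intros cU cV ck)
  have cf: "continuous_on {0..1} (?f \<circ> \<gamma>)"
    unfolding continuous_on_cong[OF refl fg]
    by (intro continuous_on_Pair continuous_on_vector3 continuous_intros cU cV ck)
  have vp: "valid_path (?f \<circ> \<gamma>)"
    unfolding valid_path_def piecewise_C1_differentiable_on_def
    by (intro conjI cf exI[of _ "{0, 1}"] C1) simp
  have sp: "speed ?f \<gamma> t = \<sigma> t" if "t \<in> {0..1} - {0, 1}" for t
    using D[of t] Dform[of t] that by (auto simp: speed_def Let_def vector_derivative_at)
  have c\<sigma>: "continuous_on {0..1} \<sigma>"
    unfolding \<sigma>_def by (intro continuous_intros ck)
  have si: "speed ?f \<gamma> integrable_on {0..1}"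
    by (rule integrable_spike_finite[of "{0, 1}", OF _ sp integrable_continuous_real[OF c\<sigma>]]) auto
  have "curve_length ?f \<gamma> = integral {0..1} \<sigma>"
    unfolding curve_length_def by (rule integral_spike[of "{0, 1}"]) (use sp in auto)
  also have "\<dots> \<le> integral {0..1::real} (\<lambda>_. \<bar>u1 - u0\<bar> + B)"
  proof (rule integral_le)
    show "\<sigma> integrable_on {0..1}" by (rule integrable_continuous_real[OF c\<sigma>])
    fix t :: real assume t: "t \<in> {0..1}"
    have "\<sigma> t \<le> \<bar>u1 - u0\<bar> + \<bar>sinh (k (U t)) * (v1 - v0)\<bar>"
      unfolding \<sigma>_def using sqrt_sum_squares_le_sum_abs[of "u1 - u0" "sinh (k (U t)) * (v1 - v0)"]
      by (simp add: power_mult_distrib)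
    also have "\<bar>sinh (k (U t)) * (v1 - v0)\<bar> \<le> B"
      using B[OF Useg[OF t]] profile_nonneg[OF UI[OF t]] by (simp add: abs_mult)
    finally show "\<sigma> t \<le> \<bar>u1 - u0\<bar> + B" by simp
  qed auto
  finally have len: "curve_length ?f \<gamma> \<le> \<bar>u1 - u0\<bar> + B" by simp
  have "path_image \<gamma> \<subseteq> rev_surface I k"
    using UI by (auto simp: path_image_def \<gamma>_def rev_surface_def)
  then have "\<gamma> \<in> curves_between (rev_surface I k) ?f
      (u0, sinh (k u0) * cos v0, sinh (k u0) * sin v0) (u1, sinh (k u1) * cos v1, sinh (k u1) * sin v1)"
    using c\<gamma> vp si by (auto simp: curves_between_def path_def pathstart_def pathfinish_def \<gamma>_def U_def V_def)
  then show ?thesis using len by (rule that)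
qed

text \<open>Compactness of the parameter segment supplies the bound \<open>B\<close> for
  \<open>polar_path\<close>.\<close>

lemma curves_between_nonempty:
  assumes "u0 \<in> I" "u1 \<in> I"
  shows "curves_between (rev_surface I k) (rev_immersion k h)
      (u0, sinh (k u0) * cos v0, sinh (k u0) * sin v0) (u1, sinh (k u1) * cos v1, sinh (k u1) * sin v1) \<noteq> {}"
proof -
  have "continuous_on (closed_segment u0 u1) (\<lambda>u. sinh (k u) * \<bar>v1 - v0\<bar>)"
    using profile_segment[OF assms]
    by (intro continuous_intros continuous_on_subset[OF profile_continuous(1)])
  then obtain B where "\<And>u. u \<in> closed_segment u0 u1 \<Longrightarrow> sinh (k u) * \<bar>v1 - v0\<bar> \<le> B"
    using continuous_attains_sup[OF compact_segment] by (metis ends_in_segment(1) empty_iff)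
  from polar_path[OF assms this] show ?thesis by (metis empty_iff)
qed

lemma rev_surface_polar:
  assumes "x \<in> rev_surface I k"
  obtains u v where "u \<in> I" "x = (u, sinh (k u) * cos v, sinh (k u) * sin v)"
  using assms by (auto simp: rev_surface_def)

end

section \<open>Completeness makes the parameter interval closed\<close>

context
  fixes I :: "real set" and k h :: "real \<Rightarrow> real"
  assumes rs: "revolution_surface I k h"
begin

text \<open>If both functions were constant there, both derivatives would vanish, against unit
  speed.\<close>

lemma profile_nonconstant:
  assumes "\<alpha> < \<beta>" "{\<alpha><..<\<beta>} \<subseteq> interior I"
  shows "\<exists>p q. p \<in> {\<alpha><..<\<beta>} \<and> q \<in> {\<alpha><..<\<beta>} \<and> (k p \<noteq> k q \<or> h p \<noteq> h q)"
proof (rule ccontr)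
  assume "\<not> ?thesis"
  then have eq: "k p = k q \<and> h p = h q" if "p \<in> {\<alpha><..<\<beta>}" "q \<in> {\<alpha><..<\<beta>}" for p q
    using that by blast
  define t where "t = (\<alpha> + \<beta>) / 2"
  have t: "t \<in> {\<alpha><..<\<beta>}" using assms(1) by (simp add: t_def)
  then have ti: "t \<in> interior I" using assms(2) by blast
  have "(k has_real_derivative 0) (at t)"
    by (rule has_field_derivative_transform_within_open[OF DERIV_const[of "k t"] open_greaterThanLessThan t])
      (use eq[OF t] in blast)
  moreover have "(h has_real_derivative 0) (at t)"
    by (rule has_field_derivative_transform_within_open[OF DERIV_const[of "h t"] open_greaterThanLessThan t])
      (use eq[OF t] in blast)
  ultimately have "deriv k t = 0" "deriv h t = 0" by (simp_all add: DERIV_imp_deriv)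
  then show False using profile_unit[OF rs ti] by simp
qed

text \<open>The intermediate value theorem for the parameter, which is a coordinate of the abstract
  surface; it need not be a function of the image point.\<close>

lemma curve_passes:
  assumes \<gamma>: "\<gamma> \<in> curves_between (rev_surface I k) (rev_immersion k h) x y"
    and p: "p \<in> closed_segment (fst x) (fst y)"
  obtains t where "t \<in> {0..1}" "fst (\<gamma> t) = p"
proof -
  have "continuous_on {0..1} (\<lambda>t. fst (\<gamma> t))" and ends: "\<gamma> 0 = x" "\<gamma> 1 = y"
    using \<gamma> by (auto simp: curves_between_def path_def pathstart_def pathfinish_def intro: continuous_on_fst)
  then have "connected ((\<lambda>t. fst (\<gamma> t)) ` {0..1})"
    by (intro connected_continuous_image) auto
  then have "closed_segment (fst x) (fst y) \<subseteq> (\<lambda>t. fst (\<gamma> t)) ` {0..1}"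
    using ends by (intro closed_segment_subset) (auto simp flip: is_interval_connected_1 is_interval_convex_1 intro: rev_image_eqI)
  then show ?thesis using p that by auto
qed

text \<open>Points of one meridian over a convergent parameter sequence are Cauchy, so they have a
  limit \<open>x\<close> over some \<open>us\<close> in \<open>I\<close>. If \<open>l\<close> were
  missing, every curve from a late term to \<open>x\<close> would cross the gap between
  \<open>us\<close> and \<open>l\<close>, and its length would be bounded away from 0.\<close>

lemma riem_complete_imp_closed:
  assumes complete: "riem_complete (rev_surface I k) (rev_immersion k h)"
  shows "closed I"
  unfolding closed_sequential_limits
proof (intro allI impI, elim conjE)
  fix X l assume XI: "\<forall>n::nat. X n \<in> I" and Xl: "X \<longlonglongrightarrow> l"
  let ?M = "rev_surface I k" and ?f = "rev_immersion k h"
  let ?P = "\<lambda>u v. (u, sinh (k u) * cos v, sinh (k u) * sin v)"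
  define \<sigma> where "\<sigma> n = ?P (X n) 0" for n
  note H2 = rev_immersion_in_H2xR[OF rs]
  have "riem_dist ?M ?f (\<sigma> m) (\<sigma> n) \<le> \<bar>X n - X m\<bar>" for m n
  proof -
    obtain \<gamma> where "\<gamma> \<in> curves_between ?M ?f (?P (X m) 0) (?P (X n) 0)" "curve_length ?f \<gamma> \<le> \<bar>X n - X m\<bar> + 0"
      using XI by (rule_tac polar_path[OF rs, of "X m" "X n" 0 0 0]) auto
    then show ?thesis using riem_dist_le[OF _ H2] by (force simp: \<sigma>_def)
  qed
  moreover have "\<exists>N. \<forall>m\<ge>N. \<forall>n\<ge>N. \<bar>X n - X m\<bar> < \<epsilon>" if "\<epsilon> > 0" for \<epsilon>
    using LIMSEQ_imp_Cauchy[OF Xl] that unfolding Cauchy_def dist_real_def by (metis abs_minus_commute)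
  ultimately have "\<exists>N. \<forall>m\<ge>N. \<forall>n\<ge>N. riem_dist ?M ?f (\<sigma> m) (\<sigma> n) < \<epsilon>" if "\<epsilon> > 0" for \<epsilon>
    using that by (meson le_less_trans)
  moreover have "\<sigma> n \<in> ?M" for n
    using XI by (auto simp: \<sigma>_def rev_surface_def intro!: exI[of _ 0])
  ultimately obtain x where "x \<in> ?M" and lim: "(\<lambda>n. riem_dist ?M ?f (\<sigma> n) x) \<longlonglongrightarrow> 0"
    using complete unfolding riem_complete_def by blast
  then obtain us v where us: "us \<in> I" and x: "x = ?P us v"
    by (rule_tac rev_surface_polar[OF rs]) blast+
  show "l \<in> I"
  proof (rule ccontr)
    assume l: "l \<notin> I"
    with us have ne: "us \<noteq> l" by auto
    define \<alpha> \<beta> where "\<alpha> = min us l" "\<beta> = max us l"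
    have \<alpha>\<beta>: "\<alpha> < \<beta>" using ne by (auto simp: \<alpha>_\<beta>_def)
    have inside: "eventually (\<lambda>n. t \<in> open_segment us (X n)) sequentially" if "t \<in> {\<alpha><..<\<beta>}" for t
    proof (cases "us < l")
      case True
      then have "us < t" "t < l" using that by (auto simp: \<alpha>_\<beta>_def)
      then show ?thesis using order_tendstoD(1)[OF Xl \<open>t < l\<close>]
        by (auto elim!: eventually_mono simp: open_segment_eq_real_ivl)
    next
      case False
      then have "l < t" "t < us" using that by (auto simp: \<alpha>_\<beta>_def)
      then show ?thesis using order_tendstoD(2)[OF Xl \<open>l < t\<close>]
        by (auto elim!: eventually_mono simp: open_segment_eq_real_ivl)
    qed
    have int: "{\<alpha><..<\<beta>} \<subseteq> interior I"
    proof
      fix t assume "t \<in> {\<alpha><..<\<beta>}"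
      then obtain n where "t \<in> open_segment us (X n)"
        using eventually_happens'[OF _ inside] by auto
      then show "t \<in> interior I"
        using profile_between[OF rs, of us "X n" t] profile_between[OF rs, of "X n" us t] us XI
        by (auto simp: open_segment_eq_real_ivl split: if_splits)
    qed
    obtain p q where pq: "p \<in> {\<alpha><..<\<beta>}" "q \<in> {\<alpha><..<\<beta>}" "k p \<noteq> k q \<or> h p \<noteq> h q"
      using profile_nonconstant[OF \<alpha>\<beta> int] by blast
    \<comment> \<open>Positive because \<open>cosh\<close> is injective on the positive values of
      \<open>k\<close>. For large \<open>n\<close> any curve from \<open>\<sigma> n\<close> to
      \<open>x\<close> runs over both \<open>p\<close> and \<open>q\<close>, so it is at least this
      long.\<close>
    define \<delta> where "\<delta> = max \<bar>ln (cosh (k p)) - ln (cosh (k q))\<bar> \<bar>h p - h q\<bar>"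
    have "0 < k p" "0 < k q" using pq int profile_pos[OF rs] by auto
    then have "cosh (k p) \<noteq> cosh (k q)" if "k p \<noteq> k q"
      using that cosh_real_nonneg_less_iff[of "k p" "k q"] cosh_real_nonneg_less_iff[of "k q" "k p"] by linarith
    then have \<delta>: "\<delta> > 0" using pq(3) by (auto simp: \<delta>_def less_max_iff_disj)
    have "eventually (\<lambda>n. p \<in> open_segment us (X n) \<and> q \<in> open_segment us (X n)
        \<and> riem_dist ?M ?f (\<sigma> n) x < \<delta>) sequentially"
      using inside[OF pq(1)] inside[OF pq(2)] order_tendstoD(2)[OF lim \<delta>] by eventually_elim auto
    then obtain n where n: "p \<in> open_segment us (X n)" "q \<in> open_segment us (X n)" "riem_dist ?M ?f (\<sigma> n) x < \<delta>"
      using eventually_happens'[OF sequentially_bot] by blast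
    have "\<delta> \<le> riem_dist ?M ?f (\<sigma> n) x"
    proof (rule riem_dist_ge)
      have "curves_between ?M ?f (?P (X n) 0) (?P us v) \<noteq> {}"
        using XI us by (intro curves_between_nonempty[OF rs]) auto
      then show "curves_between ?M ?f (\<sigma> n) x \<noteq> {}" by (simp add: \<sigma>_def x)
      fix \<gamma> assume \<gamma>: "\<gamma> \<in> curves_between ?M ?f (\<sigma> n) x"
      have "p \<in> closed_segment (fst (\<sigma> n)) (fst x)" "q \<in> closed_segment (fst (\<sigma> n)) (fst x)"
        using n by (auto simp: \<sigma>_def x closed_segment_commute open_segment_def)
      then obtain s t where st: "s \<in> {0..1}" "fst (\<gamma> s) = p" "t \<in> {0..1}" "fst (\<gamma> t) = q"
        using curve_passes[OF \<gamma>] by metis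
      show "\<delta> \<le> curve_length ?f \<gamma>"
        using curve_length_ge_height[OF \<gamma> H2 st(3,1)] curve_length_ge_ln[OF \<gamma> H2 st(3,1)] st
        by (auto simp: \<delta>_def rev_immersion_def split_beta)
    qed
    with n(3) show False by simp
  qed
qed

end

section \<open>Curvature at least \<open>-1\<close>\<close>

lemma closed_real_Sup:
  fixes I :: "real set"
  assumes "closed I" "I \<noteq> {}" "bdd_above I"
  shows "Sup I \<in> I" "Sup I \<notin> interior I"
proof -
  show "Sup I \<in> I" using closed_contains_Sup assms by blast
  show "Sup I \<notin> interior I"
  proof
    assume "Sup I \<in> interior I"
    then obtain e where e: "e > 0" "ball (Sup I) e \<subseteq> I" using mem_interior by blast
    then have "Sup I + e / 2 \<in> I" by (auto simp: dist_real_def subset_iff)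
    then show False using cSup_upper[OF _ assms(3)] e(1) by fastforce
  qed
qed

lemma closed_real_Inf:
  fixes I :: "real set"
  assumes "closed I" "I \<noteq> {}" "bdd_below I"
  shows "Inf I \<in> I" "Inf I \<notin> interior I"
proof -
  show "Inf I \<in> I" using closed_contains_Inf assms by blast
  show "Inf I \<notin> interior I"
  proof
    assume "Inf I \<in> interior I"
    then obtain e where e: "e > 0" "ball (Inf I) e \<subseteq> I" using mem_interior by blast
    then have "Inf I - e / 2 \<in> I" by (auto simp: dist_real_def subset_iff)
    then show False using cInf_lower[OF _ assms(3)] e(1) by fastforce
  qed
qed

text \<open>A positive slope at \<open>u0\<close> keeps \<open>f\<close> above an increasing tangent
  line to the right. The line exceeds \<open>B\<close> in finite time, so \<open>I\<close> must end
  before that; but at this end \<open>f\<close> would have to drop to 0.\<close>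

lemma bounded_convex_not_increasing:
  fixes f f1 :: "real \<Rightarrow> real"
  assumes I: "is_interval I" "closed I" and cont: "continuous_on I f"
    and f: "\<And>u. u \<in> interior I \<Longrightarrow> (f has_real_derivative f1 u) (at u)"
    and f1: "\<And>u. u \<in> interior I \<Longrightarrow> (f1 has_real_derivative f2 u) (at u)"
    and f2: "\<And>u. u \<in> interior I \<Longrightarrow> 0 \<le> f2 u"
    and pos: "\<And>u. u \<in> interior I \<Longrightarrow> 0 < f u" and zero: "\<And>u. u \<in> I - interior I \<Longrightarrow> f u = 0"
    and bound: "\<And>u. u \<in> interior I \<Longrightarrow> f u \<le> B"
    and u0: "u0 \<in> interior I"
  shows "f1 u0 \<le> 0"
proof (rule ccontr)
  assume "\<not> f1 u0 \<le> 0"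
  then have m: "0 < f1 u0" by simp
  have u0I: "u0 \<in> I" using u0 interior_subset by blast
  have int: "{u0..u} \<subseteq> interior I" if "u \<in> interior I" for u
    using I(1) u0 that by (metis is_interval_connected_1 is_interval_convex_1 convex_interior connected_contains_Icc)
  have mono: "f1 u0 \<le> f1 u" if "u0 \<le> u" "u \<in> interior I" for u
    by (rule DERIV_nonneg_imp_nondecreasing[OF that(1)]) (meson f1 f2 int that(2) atLeastAtMost_iff subsetD)
  have lin: "f u0 + f1 u0 * (u - u0) \<le> f u" if u: "u0 \<le> u" "u \<in> interior I" for u
  proof -
    have "f u0 - f1 u0 * u0 \<le> f u - f1 u0 * u"
    proof (rule DERIV_nonneg_imp_nondecreasing[OF u(1)])
      fix x assume "u0 \<le> x" "x \<le> u"
      then have "x \<in> interior I" using int u by (meson atLeastAtMost_iff subsetD)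
      then show "\<exists>y. ((\<lambda>u. f u - f1 u0 * u) has_real_derivative y) (at x) \<and> 0 \<le> y"
        using f mono \<open>u0 \<le> x\<close> by (intro exI[of _ "f1 x - f1 u0"]) (auto intro!: derivative_eq_intros)
    qed
    then show ?thesis by (simp add: algebra_simps)
  qed
  have nobdry: "b \<in> interior I" if b: "b \<in> I" "u0 \<le> b" for b
  proof (rule ccontr)
    assume nb: "b \<notin> interior I"
    then have lt: "u0 < b" using b u0 by (cases "u0 = b") auto
    have sub: "{u0..b} \<subseteq> I" using I(1) u0I b by (meson is_interval_connected_1 connected_contains_Icc)
    then have ii: "{u0<..<b} \<subseteq> interior I"
      by (meson greaterThanLessThan_subseteq_atLeastAtMost_iff interior_maximal open_greaterThanLessThan order_trans order_refl)
    have "f u0 \<le> f b"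
    proof (rule continuous_ge_on_closure[of "{u0<..<b}" f])
      show "continuous_on (closure {u0<..<b}) f" using continuous_on_subset[OF cont sub] lt by simp
      show "b \<in> closure {u0<..<b}" using lt by simp
      fix x assume "x \<in> {u0<..<b}"
      then show "f u0 \<le> f x" using lin[of x] ii m by (smt (verit) greaterThanLessThan_iff mult_nonneg_nonneg subsetD)
    qed
    then show False using pos[OF u0] zero[of b] b nb by auto
  qed
  \<comment> \<open>Here the tangent line has the value \<open>f u0 + B + 1\<close>, which is above
    \<open>B\<close>.\<close>
  define T where "T = u0 + (B + 1) / f1 u0"
  have B: "0 < B" using pos[OF u0] bound[OF u0] by linarith
  then have T: "u0 \<le> T" using m by (simp add: T_def)
  have "T \<notin> I"
  proof
    assume "T \<in> I"
    then have "T \<in> interior I" using nobdry T by blast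
    then show False using lin[OF T] bound[of T] pos[OF u0] m by (simp add: T_def)
  qed
  then have "x \<le> T" if "x \<in> I" for x
    using I(1) u0I that T unfolding is_interval_1 by (meson linear)
  then have "bdd_above I" by (rule bdd_aboveI)
  then have "Sup I \<in> I" "Sup I \<notin> interior I" "u0 \<le> Sup I"
    using closed_real_Sup[OF I(2)] u0I cSup_upper by auto
  then show False using nobdry by blast
qed

context
  fixes I :: "real set" and k h :: "real \<Rightarrow> real" and K :: real
  assumes rs: "revolution_surface I k h" and K: "constant_gauss_curvature I k h K"
begin

lemma sinh_profile_deriv:
  assumes "u \<in> interior I"
  shows "((\<lambda>u. sinh (k u)) has_real_derivative cosh (k u) * deriv k u) (at u)"
  using profile_derivatives(1)[OF rs assms] by (auto intro!: derivative_eq_intros)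

lemma sinh_profile_ode:
  assumes u: "u \<in> interior I"
  shows "((\<lambda>u. cosh (k u) * deriv k u) has_real_derivative - K * sinh (k u)) (at u)"
proof -
  define f2 where "f2 u = sinh (k u) * deriv k u * deriv k u + cosh (k u) * deriv (deriv k) u" for u
  have f2: "((\<lambda>u. cosh (k u) * deriv k u) has_real_derivative f2 u) (at u)" if "u \<in> interior I" for u
    using profile_derivatives(1,3)[OF rs that] by (auto intro!: derivative_eq_intros simp: f2_def)
  define p :: "real^2" where "p = vector [u, 0]"
  have p: "p $ 1 = u" by (simp add: p_def)
  have "gauss_curvature (induced_metric (\<lambda>q. revolve k h (q $ 1) (q $ 2))) p = - f2 (p $ 1) / sinh (k (p $ 1))"
    by (rule gauss_curvature_revolve[OF profile_interval(3)[OF rs], where ?k1.0 = "deriv k" and ?h1.0 = "deriv h"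
          and ?f1.0 = "\<lambda>u. cosh (k u) * deriv k u"])
      (simp_all add: u p profile_derivatives(1,2)[OF rs] profile_unit[OF rs] profile_pos[OF rs]
        sinh_profile_deriv f2)
  moreover have "gauss_curvature (induced_metric (\<lambda>q. revolve k h (q $ 1) (q $ 2))) p = K"
    using K u unfolding constant_gauss_curvature_def by (simp add: p)
  ultimately have "K = - f2 (p $ 1) / sinh (k (p $ 1))" by simp
  then have "f2 u = - K * sinh (k u)"
    using profile_pos[OF rs u] by (simp add: p field_simps)
  then show ?thesis using f2[OF u] by simp
qed

lemma sinh_profile_deriv_le:
  assumes "u \<in> interior I"
  shows "(cosh (k u) * deriv k u)\<^sup>2 \<le> 1 + (sinh (k u))\<^sup>2"
proof -
  have "(deriv k u)\<^sup>2 \<le> 1" using profile_unit[OF rs assms] by (smt (verit) zero_le_power2)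
  then have "(cosh (k u))\<^sup>2 * (deriv k u)\<^sup>2 \<le> (cosh (k u))\<^sup>2 * 1" by (intro mult_left_mono) auto
  then show ?thesis by (simp add: power_mult_distrib cosh_square_eq)
qed

lemma closed_imp_curvature_ge:
  assumes cl: "closed I"
  shows "-1 \<le> K"
proof (rule ccontr)
  assume "\<not> -1 \<le> K"
  then have K1: "K < -1" by simp
  define f where "f u = sinh (k u)" for u
  define f1 where "f1 u = cosh (k u) * deriv k u" for u
  have f: "(f has_real_derivative f1 u) (at u)" "(f1 has_real_derivative - K * f u) (at u)"
    "0 < f u" "(f1 u)\<^sup>2 \<le> 1 + (f u)\<^sup>2" if "u \<in> interior I" for u
    using sinh_profile_deriv[OF that] sinh_profile_ode[OF that] profile_pos[OF rs that] sinh_profile_deriv_le[OF that]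
    by (simp_all add: f_def[abs_def] f1_def[abs_def])
  note int = profile_interval[OF rs]
  have cont: "continuous_on I f" unfolding f_def by (intro continuous_intros profile_continuous(1)[OF rs])
  have zero: "f u = 0" if "u \<in> I - interior I" for u using profile_pole(1)[OF rs that] by (simp add: f_def)
  have "\<exists>C. \<forall>u\<in>interior I. (f1 u)\<^sup>2 + K * (f u)\<^sup>2 = C"
  proof (rule has_field_derivative_zero_constant)
    show "convex (interior I)" using int(4) by (simp add: is_interval_convex_1)
    fix u assume u: "u \<in> interior I"
    have "((\<lambda>u. (f1 u)\<^sup>2 + K * (f u)\<^sup>2) has_real_derivative 0) (at u)"
      by (auto intro!: derivative_eq_intros f(1,2)[OF u])
    then show "((\<lambda>u. (f1 u)\<^sup>2 + K * (f u)\<^sup>2) has_real_derivative 0) (at u within interior I)"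
      by (rule has_field_derivative_at_within)
  qed
  then obtain C where C: "\<And>u. u \<in> interior I \<Longrightarrow> (f1 u)\<^sup>2 + K * (f u)\<^sup>2 = C" by blast
  \<comment> \<open>Inserting f'^2 \<le> 1 + f^2 into the conserved quantity gives (-K - 1) f^2
    \<le> 1 - C, and -K - 1 is positive.\<close>
  define B where "B = (1 - C) / (- K - 1)"
  have fB: "(f u)\<^sup>2 \<le> B" if "u \<in> interior I" for u
    using f(4)[OF that] C[OF that] K1 by (simp add: B_def field_simps)
  have bound: "f u \<le> sqrt B" if "u \<in> interior I" for u
    using fB[OF that] f(3)[OF that] by (simp add: real_le_rsqrt)
  have "f1 u \<le> 0" if "u \<in> interior I" for u
    by (rule bounded_convex_not_increasing[OF int(1) cl cont f(1,2) _ f(3) zero bound that])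
      (use f(3) K1 in \<open>auto simp: mult_nonpos_nonneg less_imp_le\<close>)
  \<comment> \<open>The profile run backwards excludes negative slopes as well.\<close>
  moreover have "0 \<le> f1 u" if u: "u \<in> interior I" for u
  proof -
    have im: "is_interval (uminus ` I)" "closed (uminus ` I)" "interior (uminus ` I) = uminus ` interior I"
      using int(1) cl by (auto simp: closed_negations interior_negations is_interval_neg_translationI)
    have "- f1 (- (- u)) \<le> 0"
    proof (rule bounded_convex_not_increasing[OF im(1,2), where f = "\<lambda>u. f (- u)" and ?f1.0 = "\<lambda>u. - f1 (- u)"
          and ?f2.0 = "\<lambda>u. - K * f (- u)" and B = "sqrt B"], unfold im(3))
      show "continuous_on (uminus ` I) (\<lambda>u. f (- u))"
        by (rule continuous_on_compose2[OF cont]) (auto intro!: continuous_intros)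
      fix v assume v: "v \<in> uminus ` interior I"
      then have mv: "- v \<in> interior I" by auto
      show "((\<lambda>u. f (- u)) has_real_derivative - f1 (- v)) (at v)"
        using DERIV_chain2[OF f(1)[OF mv] DERIV_minus[OF DERIV_ident]] by simp
      show "((\<lambda>u. - f1 (- u)) has_real_derivative - K * f (- v)) (at v)"
        using DERIV_minus[OF DERIV_chain2[OF f(2)[OF mv] DERIV_minus[OF DERIV_ident]]] by simp
      show "0 \<le> - K * f (- v)" "0 < f (- v)" "f (- v) \<le> sqrt B"
        using f(3)[OF mv] bound[OF mv] K1 by (auto simp: mult_nonpos_nonneg less_imp_le)
    next
      fix v assume "v \<in> uminus ` I - uminus ` interior I"
      then have "- v \<in> I - interior I" by (auto simp: image_iff)
      then show "f (- v) = 0" by (rule zero)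
    qed (use u in auto)
    then show ?thesis by simp
  qed
  \<comment> \<open>Now the slope vanishes identically, although its derivative
    \<open>- K * f u\<close> is positive.\<close>
  ultimately have z: "f1 u = 0" if "u \<in> interior I" for u using that by (meson antisym)
  obtain u where u: "u \<in> interior I" using int(2) by blast
  have "(f1 has_real_derivative 0) (at u)"
    by (rule has_field_derivative_transform_within_open[OF DERIV_const[of 0] int(3) u]) (simp add: z)
  then have "- K * f u = 0" using f(2)[OF u] DERIV_unique by blast
  then show False using f(3)[OF u] K1 by simp
qed

end

section \<open>Profiles of constant positive curvature\<close>

text \<open>For z = f + i f1 / \<omega> the system reads z' = - i \<omega> z, so z rotates
  uniformly. Positivity of \<open>f u0\<close> puts \<open>u0\<close> inside one positive half-wave
  of the sine, whose left end is \<open>a\<close>.\<close>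

lemma harmonic_oscillator:
  fixes f f1 :: "real \<Rightarrow> real"
  assumes J: "open J" "is_interval J" "u0 \<in> J" and \<omega>: "\<omega> > 0"
    and f: "\<And>u. u \<in> J \<Longrightarrow> (f has_real_derivative f1 u) (at u)"
    and f1: "\<And>u. u \<in> J \<Longrightarrow> (f1 has_real_derivative - \<omega>\<^sup>2 * f u) (at u)"
    and pos: "f u0 > 0"
  obtains a R where "R > 0" "u0 \<in> {a<..<a + pi / \<omega>}"
    "\<And>u. u \<in> J \<Longrightarrow> f u = R * sin (\<omega> * (u - a))" "\<And>u. u \<in> J \<Longrightarrow> f1 u = R * \<omega> * cos (\<omega> * (u - a))"
proof -
  \<comment> \<open>\<open>W1\<close> and \<open>W2\<close> are the real and imaginary parts of z
    e^(i \<omega> (u - u0)), which is conserved.\<close>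
  define W1 where "W1 u = f u * cos (\<omega> * (u - u0)) - f1 u / \<omega> * sin (\<omega> * (u - u0))" for u
  define W2 where "W2 u = f u * sin (\<omega> * (u - u0)) + f1 u / \<omega> * cos (\<omega> * (u - u0))" for u
  have "(W1 has_real_derivative 0) (at u)" "(W2 has_real_derivative 0) (at u)" if "u \<in> J" for u
    unfolding W1_def W2_def using \<omega>
    by (auto intro!: derivative_eq_intros f[OF that] f1[OF that] simp: power2_eq_square field_simps)
  then have "(W1 has_real_derivative 0) (at u within J)" "(W2 has_real_derivative 0) (at u within J)" if "u \<in> J" for u
    using that by (auto intro: has_field_derivative_at_within)
  then obtain c1 c2 where "\<And>u. u \<in> J \<Longrightarrow> W1 u = c1" "\<And>u. u \<in> J \<Longrightarrow> W2 u = c2"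
    using J(2) has_field_derivative_zero_constant[of J W1] has_field_derivative_zero_constant[of J W2]
    unfolding is_interval_convex_1 by blast
  then have W: "W1 u = f u0" "W2 u = f1 u0 / \<omega>" if "u \<in> J" for u
    using that J(3) by (metis W1_def W2_def diff_self mult_zero_right cos_zero sin_zero mult.right_neutral diff_zero add_0)+
  \<comment> \<open>Polar form of the initial value \<open>(f u0, f1 u0 / \<omega>)\<close>; as
    \<open>f u0 > 0\<close>, its angle is an arctangent.\<close>
  define t where "t = f1 u0 / \<omega> / f u0"
  define \<phi> where "\<phi> = arctan t"
  define R where "R = f u0 * sqrt (1 + t\<^sup>2)"
  have s: "sqrt (1 + t\<^sup>2) > 0" by (simp add: add_pos_nonneg)
  have x: "f u0 = R * cos \<phi>" and y: "f1 u0 / \<omega> = R * sin \<phi>"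
    using s pos by (simp_all add: R_def \<phi>_def cos_arctan sin_arctan t_def)
  have R: "R > 0" using pos s by (simp add: R_def)
  have \<phi>: "- (pi/2) < \<phi>" "\<phi> < pi / 2" 
    unfolding \<phi>_def by (rule arctan_lbound arctan_ubound)+
  \<comment> \<open>The phase shift that turns R cos (\<omega> (u - u0) - \<phi>) into R sin
    (\<omega> (u - a)).\<close>
  define a where "a = u0 + \<phi> / \<omega> - pi / (2 * \<omega>)"
  have wa: "\<omega> * (u - a) = \<omega> * (u - u0) - \<phi> + pi / 2" for u
    using \<omega> by (simp add: a_def field_simps)
  show ?thesis
  proof (rule that[OF R])
    have "\<omega> * (u0 - a) > 0" "\<omega> * (u0 - a) < pi" using \<phi> by (simp_all add: wa)
    then show "u0 \<in> {a<..<a + pi / \<omega>}" using \<omega> by (simp add: zero_less_mult_iff field_simps)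
    fix u assume u: "u \<in> J"
    define \<theta> where "\<theta> = \<omega> * (u - u0)"
    have e: "f u * cos \<theta> - f1 u / \<omega> * sin \<theta> = R * cos \<phi>" "f u * sin \<theta> + f1 u / \<omega> * cos \<theta> = R * sin \<phi>"
      using W[OF u] by (simp_all add: W1_def W2_def \<theta>_def x y)
    have sc: "sin (\<omega> * (u - a)) = cos \<theta> * cos \<phi> + sin \<theta> * sin \<phi>"
      "cos (\<omega> * (u - a)) = cos \<theta> * sin \<phi> - sin \<theta> * cos \<phi>"
      unfolding wa \<theta>_def[symmetric] by (simp_all add: sin_add cos_add cos_diff sin_diff)
    have cs: "cos \<theta> * cos \<theta> + sin \<theta> * sin \<theta> = 1" by simp
    have "f u = R * cos \<phi> * cos \<theta> + R * sin \<phi> * sin \<theta>"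
      using e cs by algebra
    then show "f u = R * sin (\<omega> * (u - a))"
      unfolding sc by (simp add: algebra_simps)
    have "f1 u / \<omega> = R * sin \<phi> * cos \<theta> - R * cos \<phi> * sin \<theta>"
      using e cs by algebra
    then have "f1 u = \<omega> * (R * sin \<phi> * cos \<theta> - R * cos \<phi> * sin \<theta>)"
      using \<omega> by (simp add: field_simps)
    then show "f1 u = R * \<omega> * cos (\<omega> * (u - a))"
      unfolding sc by (simp add: algebra_simps)
  qed
qed

text \<open>\<open>sphere_h\<close> is the primitive of \<open>sqrt (1 - k'^2)\<close> for \<open>k = sphere_k\<close>; on \<open>[0, pi / sqrt c]\<close> the
  two functions are the profile with \<open>sinh k = sin (sqrt c u) / sqrt c\<close>.\<close>

definition sphere_k :: "real \<Rightarrow> real \<Rightarrow> real" where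
  "sphere_k c u = arsinh (sin (sqrt c * u) / sqrt c)"

definition sphere_h :: "real \<Rightarrow> real \<Rightarrow> real" where
  "sphere_h c u = - sqrt (c + 1) / sqrt c * arcsin (cos (sqrt c * u) / sqrt (c + 1))"

text \<open>The inequalities stay strict at the poles, where the cosine is 1 or -1, because sqrt (c
  + 1) > 1; so \<open>arcsin\<close> is differentiable at every argument that occurs.\<close>

lemma sphere_arcsin_arg:
  fixes c x :: real
  assumes "c > 0"
  shows "-1 < cos x / sqrt (c + 1)" "cos x / sqrt (c + 1) < 1"
proof -
  have "1 < sqrt (c + 1)" using assms by simp
  then have "cos x < sqrt (c + 1)" "- sqrt (c + 1) < cos x"
    using cos_le_one[of x] cos_ge_minus_one[of x] by linarith+
  then show "-1 < cos x / sqrt (c + 1)" "cos x / sqrt (c + 1) < 1"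
    using assms by (simp_all add: pos_less_divide_eq pos_divide_less_eq)
qed

lemma sphere_h_deriv:
  assumes c: "c > 0"
  shows "(sphere_h c has_real_derivative sqrt (c + 1) * sin (sqrt c * u) / sqrt (c + (sin (sqrt c * u))\<^sup>2)) (at u)"
proof -
  define x where "x = sqrt c * u"
  have "1 - (cos x / sqrt (c + 1))\<^sup>2 = (c + (sin x)\<^sup>2) / (c + 1)"
    using c by (simp add: power_divide cos_squared_eq field_simps)
  then have "inverse (sqrt (1 - (cos x / sqrt (c + 1))\<^sup>2)) = sqrt (c + 1) / sqrt (c + (sin x)\<^sup>2)"
    by (simp add: real_sqrt_divide)
  moreover have "((\<lambda>u. cos (sqrt c * u) / sqrt (c + 1)) has_real_derivative - sin x * sqrt c / sqrt (c + 1)) (at u)"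
    unfolding x_def by (rule DERIV_cdivide) (auto intro!: derivative_eq_intros)
  then have "(sphere_h c has_real_derivative - sqrt (c + 1) / sqrt c *
      (inverse (sqrt (1 - (cos x / sqrt (c + 1))\<^sup>2)) * (- sin x * sqrt c / sqrt (c + 1)))) (at u)"
    unfolding sphere_h_def x_def
    by (intro DERIV_cmult 
      DERIV_chain2[where f = arcsin and g = "\<lambda>u. cos (sqrt c * u) / sqrt (c + 1)", OF DERIV_arcsin[OF sphere_arcsin_arg[OF c]]])
  moreover have "- s / r * (s / q * (- y * r / s)) = s * y / q" if "s \<noteq> 0" "r \<noteq> 0" for s r q y :: real
    using that by simp
  moreover have "sqrt (c + 1) \<noteq> 0" "sqrt c \<noteq> 0" using c by simp_all
  ultimately show ?thesis by (simp only: x_def[symmetric] simp_thms)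
qed

lemma sphere_k_deriv:
  assumes c: "c > 0"
  shows "(sphere_k c has_real_derivative sqrt c * cos (sqrt c * u) / sqrt (c + (sin (sqrt c * u))\<^sup>2)) (at u)"
proof -
  define x where "x = sqrt c * u"
  have "(sin x / sqrt c)\<^sup>2 + 1 = (c + (sin x)\<^sup>2) / c"
    using c by (simp add: power_divide field_simps)
  then have "1 / sqrt ((sin x / sqrt c)\<^sup>2 + 1) = sqrt c / sqrt (c + (sin x)\<^sup>2)"
    by (simp add: real_sqrt_divide)
  moreover have "((\<lambda>u. sin (sqrt c * u) / sqrt c) has_real_derivative cos x * sqrt c / sqrt c) (at u)"
    unfolding x_def by (rule DERIV_cdivide) (auto intro!: derivative_eq_intros)
  then have "(sphere_k c has_real_derivative 1 / sqrt ((sin x / sqrt c)\<^sup>2 + 1) * (cos x * sqrt c / sqrt c)) (at u)"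
    unfolding sphere_k_def x_def by (rule DERIV_chain2[OF arsinh_real_has_field_derivative])
  moreover have "r / q * (y * r / r) = r * y / q" for r q y :: real
    by simp
  ultimately show ?thesis by (simp only: x_def[symmetric])
qed

text \<open>The numerators add up to c cos^2 x + (c + 1) sin^2 x = c + sin^2 x.\<close>

lemma sphere_speed:
  assumes c: "c > 0"
  shows "(sqrt c * cos x / sqrt (c + (sin x)\<^sup>2))\<^sup>2 + (sqrt (c + 1) * sin x / sqrt (c + (sin x)\<^sup>2))\<^sup>2 = 1"
proof -
  have "0 < c + (sin x)\<^sup>2" using c by (simp add: add_pos_nonneg)
  then show ?thesis
    using c by (simp add: power_divide power_mult_distrib cos_squared_eq divide_simps) (simp add: algebra_simps)
qed

section \<open>Uniqueness of the closed profile of curvature \<open>c\<close>\<close>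

context
  fixes I :: "real set" and k h :: "real \<Rightarrow> real" and c :: real
  assumes rs: "revolution_surface I k h" and K: "constant_gauss_curvature I k h c" and c: "c > 0"
    and cl: "closed I"
begin

text \<open>Positivity confines \<open>I\<close> to one half-wave of the sine. A boundary point in
  \<open>I\<close> is a pole, hence a zero of the sine; closedness makes \<open>Sup I\<close> and
  \<open>Inf I\<close> such points, so \<open>I\<close> is the whole half-wave.\<close>

lemma positive_curvature_profile:
  obtains a R where "R > 0" "I = {a..a + pi / sqrt c}"
    "\<And>u. u \<in> interior I \<Longrightarrow> sinh (k u) = R * sin (sqrt c * (u - a))"
    "\<And>u. u \<in> interior I \<Longrightarrow> cosh (k u) * deriv k u = R * sqrt c * cos (sqrt c * (u - a))"
proof -
  note int = profile_interval[OF rs]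
  obtain u0 where u0: "u0 \<in> interior I" using int(2) by blast
  define \<omega> where "\<omega> = sqrt c"
  have \<omega>: "\<omega> > 0" "\<omega>\<^sup>2 = c" using c by (simp_all add: \<omega>_def)
  obtain a R where R: "R > 0" and u0ab: "u0 \<in> {a<..<a + pi / \<omega>}"
    and f: "\<And>u. u \<in> interior I \<Longrightarrow> sinh (k u) = R * sin (\<omega> * (u - a))"
    and f1: "\<And>u. u \<in> interior I \<Longrightarrow> cosh (k u) * deriv k u = R * \<omega> * cos (\<omega> * (u - a))"
    by (rule harmonic_oscillator[OF int(3,4) u0 \<omega>(1), of "\<lambda>u. sinh (k u)" "\<lambda>u. cosh (k u) * deriv k u"])
      (use sinh_profile_deriv[OF rs K] sinh_profile_ode[OF rs K] profile_pos[OF rs u0] \<omega>(2) in auto)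
  define b where "b = a + pi / \<omega>"
  have fb: "sin (\<omega> * (b - a)) = 0" using \<omega>(1) by (simp add: b_def)
  have fa: "sin (\<omega> * (a - a)) = 0" by simp
  have nab: "a \<notin> interior I" "b \<notin> interior I"
    using f[of a] f[of b] fa fb profile_pos[OF rs, of a] profile_pos[OF rs, of b] by auto
  have u0I: "u0 \<in> I" using u0 interior_subset by blast
  have sub: "I \<subseteq> {a..b}"
    using profile_between[OF rs] nab u0I u0ab unfolding b_def[symmetric]
    by (smt (verit) atLeastAtMost_iff greaterThanLessThan_iff subsetI)
  have bdd: "bdd_above I" "bdd_below I" using sub by (meson bdd_above_Icc bdd_below_Icc bdd_above_mono bdd_below_mono)+
  have ne: "I \<noteq> {}" using u0I by blast
  have cont: "continuous_on I (\<lambda>u. sinh (k u) - R * sin (\<omega> * (u - a)))"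
    by (intro continuous_intros profile_continuous(1)[OF rs])
  have "convex I" using int(1) by (simp add: is_interval_convex_1)
  then have clI: "closure (interior I) = I"
    using convex_closure_interior[of I] int(2) cl by simp
  have ext: "sinh (k u) - R * sin (\<omega> * (u - a)) = 0" if "u \<in> I" for u
    by (rule continuous_constant_on_closure[of "interior I"]) (use cont f that in \<open>simp_all add: clI\<close>)
  have zeros: "u = a \<or> u = b" if "u \<in> I" "u \<notin> interior I" for u
  proof (rule ccontr)
    assume "\<not> (u = a \<or> u = b)"
    then have "a < u" "u < b" using sub that(1) by force+
    then have "0 < \<omega> * (u - a)" "\<omega> * (u - a) < pi" using \<omega>(1) by (simp_all add: b_def field_simps)
    then have "sin (\<omega> * (u - a)) > 0" by (rule sin_gt_zero)
    then show False using ext[OF that(1)] profile_pole(1)[OF rs] that R by auto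
  qed
  have "Sup I = b"
    using zeros[OF closed_real_Sup[OF cl ne bdd(1)]] cSup_upper[OF u0I bdd(1)] u0ab by auto
  moreover have "Inf I = a"
    using zeros[OF closed_real_Inf[OF cl ne bdd(2)]] cInf_lower[OF u0I bdd(2)] u0ab unfolding b_def by auto
  ultimately have "a \<in> I" "b \<in> I"
    using closed_real_Sup[OF cl ne bdd(1)] closed_real_Inf[OF cl ne bdd(2)] by auto
  then have "I = {a..b}"
    using sub int(1) unfolding is_interval_1 by (meson atLeastAtMost_iff subsetI subset_antisym)
  then show ?thesis using that R f f1 unfolding b_def \<omega>_def by blast
qed

text \<open>At a pole \<open>h' = 0\<close>, so the profile is orthogonal to the axis and \<open>sinh k\<close> has slope 1 there.\<close>

lemma positive_curvature_slope:
  assumes I: "I = {a..b}" "a < b"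
    and f: "\<And>u. u \<in> interior I \<Longrightarrow> sinh (k u) = R * sin (\<omega> * (u - a))"
    and f1: "\<And>u. u \<in> interior I \<Longrightarrow> cosh (k u) * deriv k u = R * \<omega> * cos (\<omega> * (u - a))"
  shows "(R * \<omega>)\<^sup>2 = 1"
proof (rule ccontr)
  assume ne: "(R * \<omega>)\<^sup>2 \<noteq> 1"
  have int: "interior I = {a<..<b}" by (simp add: I)
  have "smooth_pole I k h a" using profile_pole(2)[OF rs, of a] I by (simp add: int)
  then have "((\<lambda>u. (h u - h a) / (u - a)) \<longlongrightarrow> 0) (at a within I)"
    by (simp add: smooth_pole_def has_field_derivative_iff)
  then have hlim: "((\<lambda>u. ((h u - h a) / (u - a))\<^sup>2) \<longlongrightarrow> 0\<^sup>2) (at a within I)"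
    by (rule tendsto_power)
  \<comment> \<open>Closed form of h'^2 = 1 - k'^2 on the interior, continuous at \<open>a\<close>
    with value 1 - (R \<omega>)^2.\<close>
  define g where "g u = 1 - (R * \<omega> * cos (\<omega> * (u - a)))\<^sup>2 / (1 + (R * sin (\<omega> * (u - a)))\<^sup>2)" for u
  have hg: "(deriv h u)\<^sup>2 = g u" if u: "u \<in> interior I" for u
  proof -
    have "(deriv k u)\<^sup>2 = (cosh (k u) * deriv k u)\<^sup>2 / (1 + (sinh (k u))\<^sup>2)"
      by (simp add: power_mult_distrib flip: cosh_square_eq[unfolded add.commute[of _ 1]])
    then show ?thesis using profile_unit[OF rs u] by (simp add: g_def f[OF u] f1[OF u])
  qed
  have nz: "1 + (R * sin (\<omega> * (u - a)))\<^sup>2 \<noteq> 0" for u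
    by (smt (verit) zero_le_power2)
  have "isCont g a" unfolding g_def by (intro continuous_intros nz)
  then have "(g \<longlongrightarrow> g a) (at a within I)"
    by (meson continuous_at_imp_continuous_at_within continuous_within)
  \<comment> \<open>No number is within \<open>\<epsilon>\<close> of both 0 and
    \<open>g a\<close>.\<close>
  define \<epsilon> where "\<epsilon> = \<bar>g a\<bar> / 2"
  have \<epsilon>: "\<epsilon> > 0" using ne by (simp add: \<epsilon>_def g_def)
  obtain d1 where d1: "d1 > 0" "\<And>u. \<lbrakk>u \<in> I; u \<noteq> a; \<bar>u - a\<bar> < d1\<rbrakk> \<Longrightarrow> \<bar>g u - g a\<bar> < \<epsilon>"
    using tendstoD[OF \<open>(g \<longlongrightarrow> g a) (at a within I)\<close> \<epsilon>] unfolding eventually_at dist_real_def by blast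
  obtain d2 where d2: "d2 > 0" "\<And>u. \<lbrakk>u \<in> I; u \<noteq> a; \<bar>u - a\<bar> < d2\<rbrakk> \<Longrightarrow> \<bar>((h u - h a) / (u - a))\<^sup>2 - 0\<^sup>2\<bar> < \<epsilon>"
    using tendstoD[OF hlim \<epsilon>] unfolding eventually_at dist_real_def by blast
  define t where "t = a + min (min d1 d2) (b - a) / 2"
  have t: "a < t" "t < b" "t - a < d1" "t - a < d2" using d1(1) d2(1) I(2) by (auto simp: t_def min_def field_simps)
  \<comment> \<open>By the mean value theorem the difference quotient at \<open>a\<close> is a
    nearby value of \<open>deriv h\<close>, so its square is \<open>g z\<close>; being close to both
    0 and \<open>g a\<close> is the contradiction.\<close>
  have "\<exists>l z. a < z \<and> z < t \<and> (h has_real_derivative l) (at z) \<and> h t - h a = (t - a) * l"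
  proof (rule MVT[OF t(1)])
    show "continuous_on {a..t} h" using profile_continuous(2)[OF rs] by (rule continuous_on_subset) (use I t in auto)
    show "h differentiable (at x)" if "a < x" "x < t" for x
      using profile_derivatives(2)[OF rs, of x] that t(2) by (auto simp: int real_differentiable_def)
  qed
  then obtain z where z: "a < z" "z < t" and "h t - h a = (t - a) * deriv h z"
    using DERIV_imp_deriv by metis
  then have "((h t - h a) / (t - a))\<^sup>2 = g z"
    using hg[of z] t by (simp add: int)
  then have "\<bar>g z\<bar> < \<epsilon>" using d2(2)[of t] t by (simp add: I)
  moreover have "\<bar>g z - g a\<bar> < \<epsilon>" using d1(2)[of z] t z by (simp add: I)
  ultimately show False unfolding \<epsilon>_def by linarith
qed

text \<open>Once the amplitude is fixed, h'^2 is the square of the positive function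
  \<open>H1\<close>. The quotient of h' by it is continuous with values in {-1, 1}, hence a constant
  sign \<open>e\<close>; integration then yields \<open>d\<close>.\<close>

lemma positive_curvature_sphere:
  obtains a e d where "e \<in> {-1, 1}" "I = {a..a + pi / sqrt c}"
    "\<And>u. u \<in> I \<Longrightarrow> k u = sphere_k c (u - a)" "\<And>u. u \<in> I \<Longrightarrow> h u = e * sphere_h c (u - a) + d"
proof -
  obtain a R where R: "R > 0" and I: "I = {a..a + pi / sqrt c}"
    and f: "\<And>u. u \<in> interior I \<Longrightarrow> sinh (k u) = R * sin (sqrt c * (u - a))"
    and f1: "\<And>u. u \<in> interior I \<Longrightarrow> cosh (k u) * deriv k u = R * sqrt c * cos (sqrt c * (u - a))"
    by (rule positive_curvature_profile) (rule that)
  define b where "b = a + pi / sqrt c"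
  have ab: "a < b" and Ib: "I = {a..b}" using c by (simp_all add: b_def I)
  have int: "interior I = {a<..<b}" by (simp add: Ib)
  have "R * sqrt c = 1"
    using positive_curvature_slope[OF Ib ab f f1] R c by (simp add: power2_eq_1_iff) (smt (verit) mult_pos_pos real_sqrt_gt_zero)
  then have R1: "R = 1 / sqrt c" using c by (simp add: field_simps)
  have kint: "k u = sphere_k c (u - a)" if "u \<in> interior I" for u
    using arg_cong[OF f[OF that], of arsinh] by (simp add: arsinh_sinh_real sphere_k_def R1)
  have kI: "k u = sphere_k c (u - a)" if u: "u \<in> I" for u
  proof (cases "u \<in> interior I")
    case False
    then have "u = a \<or> u = b" using u by (auto simp: int Ib)
    then have "sin (sqrt c * (u - a)) = 0" using c by (auto simp: b_def)
    then show ?thesis using profile_pole(1)[OF rs, of u] u False by (simp add: sphere_k_def)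
  qed (rule kint)
  define H1 where "H1 x = sqrt (c + 1) * sin (sqrt c * x) / sqrt (c + (sin (sqrt c * x))\<^sup>2)" for x
  have H1: "H1 (u - a) > 0" if "u \<in> interior I" for u
  proof -
    have "0 < sqrt c * (u - a)" "sqrt c * (u - a) < pi" using that c by (simp_all add: int b_def field_simps)
    then have "sin (sqrt c * (u - a)) > 0" by (rule sin_gt_zero)
    then show ?thesis using c by (simp add: H1_def add_pos_nonneg)
  qed
  have shift: "((\<lambda>u. F (u - a)) has_real_derivative D) (at u)" if "(F has_real_derivative D) (at (u - a))" for F D u
    using that DERIV_shift[of F D u "- a"] by simp
  have sq: "(deriv h u)\<^sup>2 = (H1 (u - a))\<^sup>2" if u: "u \<in> interior I" for u
  proof -
    have "(k has_real_derivative sqrt c * cos (sqrt c * (u - a)) / sqrt (c + (sin (sqrt c * (u - a)))\<^sup>2)) (at u)"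
      by (rule has_field_derivative_transform_within_open[OF shift[OF sphere_k_deriv[OF c]] profile_interval(3)[OF rs] u])
        (simp add: kint)
    then have "deriv k u = sqrt c * cos (sqrt c * (u - a)) / sqrt (c + (sin (sqrt c * (u - a)))\<^sup>2)"
      by (rule DERIV_imp_deriv)
    then show ?thesis
      using profile_unit[OF rs u] sphere_speed[OF c, of "sqrt c * (u - a)"] by (simp add: H1_def)
  qed
  define q where "q u = deriv h u / H1 (u - a)" for u
  have q: "q u \<in> {-1, 1}" if "u \<in> interior I" for u
    using sq[OF that] H1[OF that] by (auto simp: q_def power2_eq_iff)
  have "q constant_on interior I"
  proof (rule continuous_finite_range_constant)
    show "connected (interior I)" by (simp add: int)
    have "continuous_on (interior I) (\<lambda>u. H1 (u - a))"
      unfolding H1_def using c by (intro continuous_intros) (simp add: add_pos_nonneg less_imp_neq[symmetric])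
    then show "continuous_on (interior I) q"
      unfolding q_def using H1 by (intro continuous_intros profile_deriv_continuous(2)[OF rs]) (auto simp: less_imp_neq[symmetric])
    show "finite (q ` interior I)" by (rule finite_subset[of _ "{-1, 1}"]) (use q in auto)
  qed
  then obtain e where e: "\<And>u. u \<in> interior I \<Longrightarrow> q u = e" unfolding constant_on_def by blast
  obtain u0 where u0: "u0 \<in> interior I" using profile_interval(2)[OF rs] by blast
  have e1: "e \<in> {-1, 1}" using q[OF u0] e[OF u0] by simp
  have dh: "(h has_real_derivative e * H1 (u - a)) (at u)" if "u \<in> interior I" for u
    using profile_derivatives(2)[OF rs that] e[OF that] H1[OF that] by (simp add: q_def field_simps)
  have "((\<lambda>u. h u - e * sphere_h c (u - a)) has_real_derivative 0) (at u)" if "u \<in> interior I" for u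
    using DERIV_diff[OF dh[OF that] DERIV_cmult[OF shift[OF sphere_h_deriv[OF c]], of e]] by (simp add: H1_def)
  then obtain d where d: "\<And>u. u \<in> interior I \<Longrightarrow> h u - e * sphere_h c (u - a) = d"
    using has_field_derivative_zero_constant[of "interior I" "\<lambda>u. h u - e * sphere_h c (u - a)"]
      profile_interval(4)[OF rs] by (auto simp: is_interval_convex_1 intro: has_field_derivative_at_within)
  have "continuous_on I (\<lambda>u. sphere_h c (u - a))"
    using DERIV_isCont[OF shift[OF sphere_h_deriv[OF c]]] by (intro continuous_at_imp_continuous_on) blast
  then have cont: "continuous_on I (\<lambda>u. h u - e * sphere_h c (u - a))"
    by (intro continuous_intros profile_continuous(2)[OF rs])
  have "closure (interior I) = I" using ab by (simp add: int Ib)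
  then have "h u - e * sphere_h c (u - a) = d" if "u \<in> I" for u
    using continuous_constant_on_closure[of "interior I" "\<lambda>u. h u - e * sphere_h c (u - a)" d u] cont d that by simp
  then have "h u = e * sphere_h c (u - a) + d" if "u \<in> I" for u
    using that by (simp add: algebra_simps)
  then show ?thesis using that e1 I kI by blast
qed

end

section \<open>Completeness\<close>

text \<open>\<open>arccos (cos (v - w))\<close> is the distance of \<open>v - w\<close> from the
  multiples of 2 pi, so \<open>v'\<close> is the representative of the angle \<open>v\<close>
  nearest to \<open>w\<close>.\<close>

lemma angle_representative:
  fixes v w :: real
  obtains v' where "cos v' = cos v" "sin v' = sin v" "\<bar>v' - w\<bar> = arccos (cos (v - w))"
proof -
  define \<delta> where "\<delta> = arccos (cos (v - w))"
  have \<delta>: "0 \<le> \<delta>" "cos \<delta> = cos (v - w)" by (simp_all add: \<delta>_def arccos_lbound)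
  have "(sin \<delta>)\<^sup>2 = (sin (v - w))\<^sup>2" by (simp add: sin_squared_eq \<delta>(2))
  then have "sin \<delta> = sin (v - w) \<or> sin \<delta> = - sin (v - w)" by (simp add: power2_eq_iff)
  then obtain e :: real where e: "e = 1 \<or> e = -1" "sin (e * \<delta>) = sin (v - w)" "cos (e * \<delta>) = cos (v - w)"
  proof
    assume "sin \<delta> = sin (v - w)"
    then show ?thesis using \<delta>(2) by (intro that[of 1]) simp_all
  next
    assume "sin \<delta> = - sin (v - w)"
    then show ?thesis using \<delta>(2) by (intro that[of "-1"]) simp_all
  qed
  have "cos (w + e * \<delta>) = cos (w + (v - w))" "sin (w + e * \<delta>) = sin (w + (v - w))"
    unfolding cos_add sin_add e(2,3) by simp_all
  then show ?thesis using that[of "w + e * \<delta>"] e(1) \<delta>(1) by (auto simp: \<delta>_def)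
qed

lemma polar_of_norm:
  fixes x y r :: real
  assumes "x\<^sup>2 + y\<^sup>2 = r\<^sup>2"
  obtains v where "x = r * cos v" "y = r * sin v"
proof -
  obtain s t where st: "x = s * cos t" "y = s * sin t" using polar_Ex by metis
  have "s\<^sup>2 * ((cos t)\<^sup>2 + (sin t)\<^sup>2) = r\<^sup>2"
    using assms unfolding st power_mult_distrib by (simp only: distrib_left)
  then have "s\<^sup>2 = r\<^sup>2" by (simp only: sin_cos_squared_add2 mult_1_right)
  \<comment> \<open>The radius may come with the wrong sign, which a half turn absorbs.\<close>
  then have "s = r \<or> s = - r" by (simp add: power2_eq_iff)
  then show ?thesis using that[of t] that[of "t + pi"] st by auto
qed

context
  fixes I :: "real set" and k h :: "real \<Rightarrow> real"
  assumes rs: "revolution_surface I k h"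
begin

text \<open>Passing to the angle nearest to \<open>v1\<close> before drawing the segment makes the
  bound insensitive to multiples of 2 pi.\<close>

lemma riem_dist_polar_le:
  assumes u: "u0 \<in> I" "u1 \<in> I" and B: "\<And>u. u \<in> I \<Longrightarrow> sinh (k u) \<le> B"
  shows "riem_dist (rev_surface I k) (rev_immersion k h)
      (u0, sinh (k u0) * cos v0, sinh (k u0) * sin v0) (u1, sinh (k u1) * cos v1, sinh (k u1) * sin v1)
    \<le> \<bar>u1 - u0\<bar> + B * arccos (cos (v0 - v1))"
proof -
  obtain v where v: "cos v = cos v0" "sin v = sin v0" "\<bar>v - v1\<bar> = arccos (cos (v0 - v1))"
    by (rule angle_representative)
  obtain \<gamma> where \<gamma>: "\<gamma> \<in> curves_between (rev_surface I k) (rev_immersion k h)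
      (u0, sinh (k u0) * cos v, sinh (k u0) * sin v) (u1, sinh (k u1) * cos v1, sinh (k u1) * sin v1)"
    "curve_length (rev_immersion k h) \<gamma> \<le> \<bar>u1 - u0\<bar> + B * \<bar>v1 - v\<bar>"
  proof (rule polar_path[OF rs u])
    fix w assume "w \<in> closed_segment u0 u1"
    then have "w \<in> I" using profile_segment[OF rs u] by blast
    then show "sinh (k w) * \<bar>v1 - v\<bar> \<le> B * \<bar>v1 - v\<bar>" using B by (intro mult_right_mono) auto
  qed (rule that)
  show ?thesis
    using riem_dist_le[OF \<gamma>(1) rev_immersion_in_H2xR[OF rs]] \<gamma>(2) v
    by (simp add: abs_minus_commute[of v1 v])
qed

lemma riem_dist_lower_bounds:
  assumes xy: "x \<in> rev_surface I k" "y \<in> rev_surface I k" and C: "C > 0" "\<And>u. u \<in> I \<Longrightarrow> cosh (k u) \<le> C"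
  defines "d \<equiv> riem_dist (rev_surface I k) (rev_immersion k h) x y"
  shows "\<bar>h (fst y) - h (fst x)\<bar> \<le> d" "\<bar>fst (snd y) - fst (snd x)\<bar> \<le> C * d"
    "\<bar>snd (snd y) - snd (snd x)\<bar> \<le> C * d"
proof -
  let ?f = "rev_immersion k h" and ?M = "rev_surface I k"
  note H2 = rev_immersion_in_H2xR[OF rs]
  have ne: "curves_between ?M ?f x y \<noteq> {}"
    using xy curves_between_nonempty[OF rs] by (auto simp: rev_surface_def)
  have f: "snd (?f z) = h (fst z)" "fst (?f z) $ 1 = cosh (k (fst z))"
    "fst (?f z) $ 2 = fst (snd z)" "fst (?f z) $ 3 = snd (snd z)" for z
    by (simp_all add: rev_immersion_def split_beta)
  have C': "fst (?f z) $ 1 \<le> C" if "z \<in> ?M" for z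
    using that C(2) by (auto simp: f rev_surface_def)
  have ends: "\<gamma> 0 = x" "\<gamma> 1 = y" if "\<gamma> \<in> curves_between ?M ?f x y" for \<gamma>
    using that by (auto simp: curves_between_def pathstart_def pathfinish_def)
  show "\<bar>h (fst y) - h (fst x)\<bar> \<le> d"
    unfolding d_def
  proof (rule riem_dist_ge[OF ne])
    fix \<gamma> assume \<gamma>: "\<gamma> \<in> curves_between ?M ?f x y"
    then show "\<bar>h (fst y) - h (fst x)\<bar> \<le> curve_length ?f \<gamma>"
      using curve_length_ge_height[OF \<gamma> H2, of 0 1] by (simp add: f ends)
  qed
  have *: "\<bar>fst (?f y) $ i - fst (?f x) $ i\<bar> / C \<le> d" for i
    unfolding d_def
  proof (rule riem_dist_ge[OF ne])
    fix \<gamma> assume \<gamma>: "\<gamma> \<in> curves_between ?M ?f x y"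
    then show "\<bar>fst (?f y) $ i - fst (?f x) $ i\<bar> / C \<le> curve_length ?f \<gamma>"
      using curve_length_ge_coord[OF \<gamma> H2 _ _ C(1) C', of 0 1 i] C(1)
      by (simp add: ends pos_divide_le_eq mult.commute)
  qed
  show "\<bar>fst (snd y) - fst (snd x)\<bar> \<le> C * d" "\<bar>snd (snd y) - snd (snd x)\<bar> \<le> C * d"
    using *[of 2] *[of 3] C(1) by (simp_all add: f pos_divide_le_eq mult.commute)
qed

text \<open>A Cauchy sequence has convergent height and planar coordinates by the lower bounds.
  Injectivity of \<open>h\<close> on the compact \<open>I\<close> makes its inverse continuous, so
  the parameters converge too; the upper bound turns this into convergence in distance.\<close>

lemma compact_imp_riem_complete:
  assumes comp: "compact I" and inj: "inj_on h I"
  shows "riem_complete (rev_surface I k) (rev_immersion k h)"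
  unfolding riem_complete_def
proof (intro allI impI, elim conjE)
  let ?f = "rev_immersion k h" and ?M = "rev_surface I k"
  let ?P = "\<lambda>u v. (u, sinh (k u) * cos v, sinh (k u) * sin v)"
  fix \<sigma> :: "nat \<Rightarrow> real \<times> real \<times> real"
  assume \<sigma>M: "\<forall>n. \<sigma> n \<in> ?M"
    and Cau: "\<forall>\<epsilon>>0. \<exists>N. \<forall>m\<ge>N. \<forall>n\<ge>N. riem_dist ?M ?f (\<sigma> m) (\<sigma> n) < \<epsilon>"
  have cont: "continuous_on I k" "continuous_on I h" by (rule profile_continuous[OF rs])+
  obtain um where um: "um \<in> I" "\<And>u. u \<in> I \<Longrightarrow> k u \<le> k um"
    using continuous_attains_sup[OF comp _ cont(1)] profile_interval(2)[OF rs] interior_subset by blast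
  define B C where "B = sinh (k um)" and "C = cosh (k um)"
  have B: "sinh (k u) \<le> B" and C': "cosh (k u) \<le> C" if "u \<in> I" for u
    using um(2)[OF that] profile_nonneg[OF rs that] profile_nonneg[OF rs um(1)]
    by (simp_all add: B_def C_def cosh_real_nonneg_le_iff)
  have C: "C > 0" by (simp add: C_def)
  note low = riem_dist_lower_bounds[OF \<sigma>M[rule_format] \<sigma>M[rule_format] C C']
  have small: "\<exists>N. \<forall>m\<ge>N. \<forall>n\<ge>N. D * riem_dist ?M ?f (\<sigma> m) (\<sigma> n) < \<epsilon>" if "\<epsilon> > 0" "D > 0" for D \<epsilon>
    using Cau[rule_format, of "\<epsilon> / D"] that by (simp add: pos_less_divide_eq mult.commute)
  have Cauchy_real: "Cauchy X" if "\<And>m n. \<bar>X n - X m\<bar> \<le> D * riem_dist ?M ?f (\<sigma> m) (\<sigma> n)" "D > 0"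
    for X :: "nat \<Rightarrow> real" and D
    unfolding Cauchy_def dist_real_def
    using small[OF _ that(2)] that(1) by (meson le_less_trans)
  have "convergent (\<lambda>n. h (fst (\<sigma> n)))"
    by (rule real_Cauchy_convergent[OF Cauchy_real[of _ 1]]) (use low(1) in auto)
  moreover have "convergent (\<lambda>n. fst (snd (\<sigma> n)))"
    by (rule real_Cauchy_convergent[OF Cauchy_real[OF low(2) C]])
  moreover have "convergent (\<lambda>n. snd (snd (\<sigma> n)))"
    by (rule real_Cauchy_convergent[OF Cauchy_real[OF low(3) C]])
  ultimately obtain \<eta> ys zs where lim: "(\<lambda>n. h (fst (\<sigma> n))) \<longlonglongrightarrow> \<eta>" "(\<lambda>n. fst (snd (\<sigma> n))) \<longlonglongrightarrow> ys"
      "(\<lambda>n. snd (snd (\<sigma> n))) \<longlonglongrightarrow> zs"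
    unfolding convergent_def by blast
  obtain v where v: "\<And>n. \<sigma> n = ?P (fst (\<sigma> n)) (v n)" and uI: "\<And>n. fst (\<sigma> n) \<in> I"
  proof -
    have "\<forall>n. \<exists>v. \<sigma> n = ?P (fst (\<sigma> n)) v \<and> fst (\<sigma> n) \<in> I"
    proof
      fix n
      obtain u' v' where "u' \<in> I" "\<sigma> n = ?P u' v'"
        using \<sigma>M[rule_format, of n] unfolding rev_surface_def by blast
      then show "\<exists>v. \<sigma> n = ?P (fst (\<sigma> n)) v \<and> fst (\<sigma> n) \<in> I" by (intro exI[of _ v']) simp
    qed
    then show ?thesis using that by metis
  qed
  define u where "u n = fst (\<sigma> n)" for n
  have u: "u n \<in> I" for n using uI by (simp add: u_def)
  have \<sigma>: "\<sigma> n = ?P (u n) (v n)" for n using v by (simp add: u_def)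
  have "closed (h ` I)" using compact_continuous_image[OF cont(2) comp] compact_imp_closed by blast
  then have \<eta>: "\<eta> \<in> h ` I"
    using lim(1) uI unfolding closed_sequential_limits by (metis (no_types, lifting) image_eqI)
  then obtain us where us: "us \<in> I" "h us = \<eta>" by blast
  have "continuous_on (h ` I) (inv_into I h)"
    by (rule continuous_on_inv[OF cont(2) comp]) (simp add: inj)
  from continuous_on_tendsto_compose[OF this lim(1) \<eta>]
  have "(\<lambda>n. inv_into I h (h (fst (\<sigma> n)))) \<longlonglongrightarrow> inv_into I h \<eta>" using uI by auto
  moreover have "inv_into I h \<eta> = us" using inv_into_f_f[OF inj us(1)] us(2) by simp
  ultimately have ulim: "u \<longlonglongrightarrow> us"
    by (simp add: u_def[abs_def] inv_into_f_f[OF inj uI])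
  have klim: "(\<lambda>n. sinh (k (u n))) \<longlonglongrightarrow> sinh (k us)"
    using continuous_on_tendsto_compose[OF cont(1) ulim us(1)] u by (intro tendsto_intros) auto
  have ylim: "(\<lambda>n. sinh (k (u n)) * cos (v n)) \<longlonglongrightarrow> ys" "(\<lambda>n. sinh (k (u n)) * sin (v n)) \<longlonglongrightarrow> zs"
    using lim(2,3) unfolding \<sigma> by simp_all
  have "(\<lambda>n. (sinh (k (u n)) * cos (v n))\<^sup>2 + (sinh (k (u n)) * sin (v n))\<^sup>2) \<longlonglongrightarrow> ys\<^sup>2 + zs\<^sup>2"
    by (intro tendsto_intros ylim)
  moreover have "(\<lambda>n. (sinh (k (u n)) * cos (v n))\<^sup>2 + (sinh (k (u n)) * sin (v n))\<^sup>2) = (\<lambda>n. (sinh (k (u n)))\<^sup>2)"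
    by (simp add: power_mult_distrib flip: distrib_left)
  moreover have "(\<lambda>n. (sinh (k (u n)))\<^sup>2) \<longlonglongrightarrow> (sinh (k us))\<^sup>2" by (intro tendsto_intros klim)
  ultimately have "ys\<^sup>2 + zs\<^sup>2 = (sinh (k us))\<^sup>2" using LIMSEQ_unique by metis
  then obtain vs where vs: "ys = sinh (k us) * cos vs" "zs = sinh (k us) * sin vs" by (rule polar_of_norm)
  have xM: "?P us vs \<in> ?M" using us(1) by (auto simp: rev_surface_def)
  \<comment> \<open>Away from a pole the angles converge modulo 2 pi. At a pole they need not, but
    there each term is joined to the limit by its own meridian.\<close>
  have "\<exists>\<delta>. \<delta> \<longlonglongrightarrow> 0 \<and> (\<forall>n. riem_dist ?M ?f (\<sigma> n) (?P us vs) \<le> \<bar>us - u n\<bar> + B * \<delta> n)"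
  proof (cases "k us = 0")
    case True
    have "riem_dist ?M ?f (\<sigma> n) (?P us vs) \<le> \<bar>us - u n\<bar> + B * 0" for n
      using riem_dist_polar_le[OF u us(1) B, of n "v n" "v n"] unfolding \<sigma> by (simp add: True)
    then show ?thesis by (intro exI[of _ "\<lambda>_. 0"]) simp
  next
    case False
    \<comment> \<open>Cosine of the angle between the planar parts of \<open>\<sigma> n\<close> and
      of the limit, as a normalised inner product.\<close>
    let ?q = "\<lambda>n. ((sinh (k (u n)) * cos (v n)) * ys + (sinh (k (u n)) * sin (v n)) * zs) / (sinh (k (u n)) * sinh (k us))"
    have "?q \<longlonglongrightarrow> (ys * ys + zs * zs) / (sinh (k us) * sinh (k us))"
      by (intro tendsto_intros ylim klim) (simp add: False)
    also have "(ys * ys + zs * zs) / (sinh (k us) * sinh (k us)) = 1"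
      using \<open>ys\<^sup>2 + zs\<^sup>2 = (sinh (k us))\<^sup>2\<close> False by (simp add: power2_eq_square)
    finally have q: "?q \<longlonglongrightarrow> 1" .
    have "eventually (\<lambda>n. sinh (k (u n)) \<noteq> 0) sequentially"
      using tendsto_imp_eventually_ne[OF klim, of 0] False by simp
    then have "eventually (\<lambda>n. ?q n = cos (v n - vs)) sequentially"
      by (rule eventually_mono) (simp add: vs cos_diff False field_simps)
    with q have "(\<lambda>n. cos (v n - vs)) \<longlonglongrightarrow> 1" by (rule Lim_transform_eventually)
    then have "(\<lambda>n. arccos (cos (v n - vs))) \<longlonglongrightarrow> arccos 1"
      by (intro continuous_on_tendsto_compose[OF continuous_on_arccos']) auto
    then show ?thesis
      using riem_dist_polar_le[OF u us(1) B] unfolding \<sigma> by (intro exI[of _ "\<lambda>n. arccos (cos (v n - vs))"]) auto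
  qed
  then obtain \<delta> where \<delta>: "\<delta> \<longlonglongrightarrow> 0" and le: "\<And>n. riem_dist ?M ?f (\<sigma> n) (?P us vs) \<le> \<bar>us - u n\<bar> + B * \<delta> n"
    by blast
  have "(\<lambda>n. \<bar>us - u n\<bar> + B * \<delta> n) \<longlonglongrightarrow> \<bar>us - us\<bar> + B * 0" by (intro tendsto_intros ulim \<delta>)
  then have lim0: "(\<lambda>n. \<bar>us - u n\<bar> + B * \<delta> n) \<longlonglongrightarrow> 0" by simp
  have ge: "0 \<le> riem_dist ?M ?f (\<sigma> n) (?P us vs)" for n
    using riem_dist_lower_bounds(1)[OF \<sigma>M[rule_format, of n] xM C C'] by linarith
  have "(\<lambda>n. riem_dist ?M ?f (\<sigma> n) (?P us vs)) \<longlonglongrightarrow> 0"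
    by (rule tendsto_sandwich[OF always_eventually[OF allI[OF ge]] always_eventually[OF allI[OF le]] tendsto_const lim0])
  then show "\<exists>x\<in>?M. (\<lambda>n. riem_dist ?M ?f (\<sigma> n) x) \<longlonglongrightarrow> 0" using xM by blast
qed

end

section \<open>The spheres\<close>

text \<open>\<open>cos x\<close> and \<open>sin x / x\<close> are smooth functions of \<open>x\<^sup>2\<close>, which makes the patch around a pole smooth.\<close>

lemma sin_cos_of_square:
  obtains S C :: "real \<Rightarrow> real"
  where "\<And>n. Ck_on n S UNIV" "\<And>n. Ck_on n C UNIV"
    "\<And>x. sin x = S (x\<^sup>2) * x" "\<And>x. cos x = C (x\<^sup>2)"
proof -
  define s c :: "nat \<Rightarrow> real" where "s n = (- 1) ^ n / fact (2 * n + 1)" and "c n = (- 1) ^ n / fact (2 * n)" for n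
  have sp: "(\<lambda>n. s n * (x\<^sup>2) ^ n * x) sums sin x" for x
    using sin_paired[of x] by (simp only: s_def power_add power_mult power_one_right mult.assoc)
  have cp: "(\<lambda>n. c n * (x\<^sup>2) ^ n) sums cos x" for x
    using cos_paired[of x] by (simp add: c_def power_mult)
  have s1: "summable (\<lambda>n. s n * (x\<^sup>2) ^ n)" if "x \<noteq> 0" for x
    using sums_summable[OF sums_divide[OF sp[of x], of x]] that by simp
  \<comment> \<open>Convergence is known only at squares of nonzero numbers; for any
    \<open>z\<close>, also a negative one, such a square exceeds \<open>\<bar>z\<bar>\<close>, and
    power series converge inside.\<close>
  have big: "norm z < norm ((sqrt (\<bar>z\<bar> + 1))\<^sup>2)" and nz: "sqrt (\<bar>z\<bar> + 1) \<noteq> 0" for z :: real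
    by (simp_all add: add_nonneg_eq_0_iff)
  have ss: "summable (\<lambda>n. s n * z ^ n)" and cs: "summable (\<lambda>n. c n * z ^ n)" for z
    by (rule powser_inside[OF s1[OF nz] big] powser_inside[OF sums_summable[OF cp] big])+
  show ?thesis
  proof (rule that)
    show "Ck_on n (\<lambda>t. \<Sum>i. s i * t ^ i) UNIV" "Ck_on n (\<lambda>t. \<Sum>i. c i * t ^ i) UNIV" for n
      by (rule Ck_on_powser[OF ss] Ck_on_powser[OF cs])+
    show "sin x = (\<Sum>i. s i * (x\<^sup>2) ^ i) * x" for x
      using sums_unique[OF sp[of x]] suminf_mult2[OF ss, of "x\<^sup>2" x] by simp
    show "cos x = (\<Sum>i. c i * (x\<^sup>2) ^ i)" for x
      by (rule sums_unique[OF cp])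
  qed
qed

lemma Ck_on_vector3:
  fixes a b c d :: "'a::euclidean_space \<Rightarrow> real"
  assumes "open S" "Ck_on n a S" "Ck_on n b S" "Ck_on n c S" "Ck_on n d S"
  shows "Ck_on n (\<lambda>w. (vector [a w, b w, c w] :: real^3, d w)) S"
proof -
  have e: "(\<lambda>w. (vector [a w, b w, c w] :: real^3, d w)) =
    (\<lambda>w. a w *\<^sub>R (axis 1 1, 0) + b w *\<^sub>R (axis 2 1, 0) + c w *\<^sub>R (axis 3 1, 0) + d w *\<^sub>R (0, 1))"
    by (simp add: fun_eq_iff vec_eq_iff forall_3 axis_def)
  show ?thesis unfolding e by (intro Ck_on_add Ck_on_scaleR Ck_on_const assms)
qed

context
  fixes c :: real
  assumes c: "c > 0"
begin

lemma sinh_sphere_k: "sinh (sphere_k c u) = sin (sqrt c * u) / sqrt c"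
  by (simp add: sphere_k_def)

lemma cosh_sphere_k: "cosh (sphere_k c u) = sqrt ((sin (sqrt c * u) / sqrt c)\<^sup>2 + 1)"
  by (simp add: sphere_k_def cosh_arsinh_real)

text \<open>With t = c |w|^2 the patch becomes smooth in \<open>Re w\<close> and
  \<open>Im w\<close>: sinh k e^(i Arg w) equals S(t) w, and the height depends on C(t) only. The
  factor \<open>e\<close> serves both poles.\<close>

lemma sphere_pole_smooth:
  "Cinf_on (\<lambda>w::complex. revolve (sphere_k c) (\<lambda>u. e * sphere_h c u) (norm w) (Arg w)) (ball 0 r)"
  unfolding Cinf_on_def
proof
  fix n
  obtain S C :: "real \<Rightarrow> real" where S: "Ck_on n S UNIV" and C: "Ck_on n C UNIV"
    and sin: "\<And>x. sin x = S (x\<^sup>2) * x" and cos: "\<And>x. cos x = C (x\<^sup>2)"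
    using sin_cos_of_square by metis
  define t :: "complex \<Rightarrow> real" where "t w = c * (Re w * Re w + Im w * Im w)" for w
  have t: "(sqrt c * norm w)\<^sup>2 = t w" for w
    using c by (simp add: t_def power_mult_distrib cmod_power2 power2_eq_square[of "Re w"] power2_eq_square[of "Im w"])
  have ri: "Ck_on n Re (ball 0 r)" "Ck_on n Im (ball 0 r)"
    by (intro Ck_on_bounded_linear open_ball bounded_linear_Re bounded_linear_Im)+
  have ct: "Ck_on n t (ball 0 r)"
    unfolding t_def by (intro Ck_on_mult Ck_on_add Ck_on_const open_ball ri)
  have cS: "Ck_on n (\<lambda>w. S (t w)) (ball 0 r)" and cC: "Ck_on n (\<lambda>w. C (t w)) (ball 0 r)"
    by (rule Ck_on_compose[OF open_ball _ S ct] Ck_on_compose[OF open_ball _ C ct]; simp)+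
  have sk: "sin (sqrt c * norm w) / sqrt c = S (t w) * norm w" for w :: complex
    using c by (simp add: sin[of "sqrt c * norm w"] t)
  have arg: "norm w * cos (Arg w) = Re w" "norm w * sin (Arg w) = Im w" for w
    using arg_cong[OF rcis_cmod_Arg[of w], of Re] arg_cong[OF rcis_cmod_Arg[of w], of Im] by simp_all
  have sq: "(S (t w) * norm w)\<^sup>2 = S (t w) * S (t w) * (Re w * Re w + Im w * Im w)" for w
    unfolding power_mult_distrib cmod_power2 by (simp add: power2_eq_square)
  have "revolve (sphere_k c) (\<lambda>u. e * sphere_h c u) (norm w) (Arg w) =
    (vector [sqrt (S (t w) * S (t w) * (Re w * Re w + Im w * Im w) + 1), S (t w) * Re w, S (t w) * Im w],
     e * (- sqrt (c + 1) / sqrt c * arcsin (C (t w) * (1 / sqrt (c + 1)))))" for w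
    using arg[of w]
    by (simp add: revolve_def sinh_sphere_k cosh_sphere_k sk sq sphere_h_def cos[of "sqrt c * norm w"] t mult.assoc)
  moreover have "Ck_on n (\<lambda>w. (vector [sqrt (S (t w) * S (t w) * (Re w * Re w + Im w * Im w) + 1), S (t w) * Re w, S (t w) * Im w] :: real^3,
     e * (- sqrt (c + 1) / sqrt c * arcsin (C (t w) * (1 / sqrt (c + 1)))))) (ball 0 r)"
  proof (intro Ck_on_vector3 open_ball Ck_on_mult cS ri Ck_on_const)
    show "Ck_on n (\<lambda>w. sqrt (S (t w) * S (t w) * (Re w * Re w + Im w * Im w) + 1)) (ball 0 r)"
    proof (rule Ck_on_compose[OF open_ball _ Ck_on_sqrt])
      show "Ck_on n (\<lambda>w. S (t w) * S (t w) * (Re w * Re w + Im w * Im w) + 1) (ball 0 r)"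
        by (intro Ck_on_add Ck_on_mult Ck_on_const open_ball ri cS)
      show "(\<lambda>w. S (t w) * S (t w) * (Re w * Re w + Im w * Im w) + 1) ` ball 0 r \<subseteq> {0<..}"
        by (auto intro!: add_nonneg_pos mult_nonneg_nonneg[OF zero_le_square sum_squares_ge_zero])
    qed
    show "Ck_on n (\<lambda>w. arcsin (C (t w) * (1 / sqrt (c + 1)))) (ball 0 r)"
    proof (rule Ck_on_compose[OF open_ball _ Ck_on_arcsin])
      show "Ck_on n (\<lambda>w. C (t w) * (1 / sqrt (c + 1))) (ball 0 r)"
        by (intro Ck_on_mult Ck_on_const open_ball cC)
      have "C (t w) = cos (sqrt c * norm w)" for w by (simp add: cos t)
      then show "(\<lambda>w. C (t w) * (1 / sqrt (c + 1))) ` ball 0 r \<subseteq> {-1<..<1}"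
        using sphere_arcsin_arg[OF c] by auto
    qed
  qed
  ultimately show "Ck_on n (\<lambda>w. revolve (sphere_k c) (\<lambda>u. e * sphere_h c u) (norm w) (Arg w)) (ball 0 r)"
    by simp
qed

text \<open>Reflection of the sphere in the slice of height 0, which exchanges the poles.\<close>

lemma sphere_antipode:
  "sphere_k c (pi / sqrt c - x) = sphere_k c x" "sphere_h c (pi / sqrt c - x) = - sphere_h c x"
proof -
  have "sqrt c * (pi / sqrt c - x) = pi - sqrt c * x" using c by (simp add: right_diff_distrib)
  then show "sphere_k c (pi / sqrt c - x) = sphere_k c x" "sphere_h c (pi / sqrt c - x) = - sphere_h c x"
    using sphere_arcsin_arg[OF c, of "sqrt c * x"]
    by (simp_all add: sphere_k_def sphere_h_def cos_diff arcsin_minus)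
qed

lemma sphere_sin_pos:
  assumes "u \<in> {0<..<pi / sqrt c}"
  shows "0 < sin (sqrt c * u)"
  using assms c by (intro sin_gt_zero) (simp_all add: pos_less_divide_eq mult.commute)

lemma sphere_revolution_surface: "revolution_surface {0..pi / sqrt c} (sphere_k c) (sphere_h c)"
  unfolding revolution_surface_def
proof (intro conjI ballI)
  let ?L = "pi / sqrt c"
  have L: "?L > 0" using c by simp
  show "is_interval {0..?L}" "interior {0..?L} \<noteq> {}" using L by simp_all
  have lin: "Ck_on n (\<lambda>u. sqrt c * u) {0<..<?L}" for n
    by (intro Ck_on_mult Ck_on_const Ck_on_ident open_greaterThanLessThan)
  note op = open_greaterThanLessThan[of 0 ?L]
  have "Ck_on n (\<lambda>u. arsinh (sin (sqrt c * u) * (1 / sqrt c))) {0<..<?L}" for n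
    by (rule Ck_on_compose[OF op _ Ck_on_arsinh Ck_on_mult[OF op Ck_on_compose[OF op _ Ck_on_sin lin] Ck_on_const]])
      simp_all
  then show "Cinf_on (sphere_k c) (interior {0..?L})"
    by (simp add: Cinf_on_def sphere_k_def[abs_def])
  have "Ck_on n (\<lambda>u. arcsin (cos (sqrt c * u) * (1 / sqrt (c + 1)))) {0<..<?L}" for n
    by (rule Ck_on_compose[OF op _ Ck_on_arcsin Ck_on_mult[OF op Ck_on_compose[OF op _ Ck_on_cos lin] Ck_on_const]])
      (use sphere_arcsin_arg[OF c] in auto)
  then have "Ck_on n (\<lambda>u. - sqrt (c + 1) / sqrt c * arcsin (cos (sqrt c * u) * (1 / sqrt (c + 1)))) {0<..<?L}" for n
    by (intro Ck_on_mult op Ck_on_const)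
  then show "Cinf_on (sphere_h c) (interior {0..?L})"
    by (simp add: Cinf_on_def sphere_h_def[abs_def])
  fix u
  show "(deriv (sphere_k c) u)\<^sup>2 + (deriv (sphere_h c) u)\<^sup>2 = 1"
    unfolding DERIV_imp_deriv[OF sphere_k_deriv[OF c]] DERIV_imp_deriv[OF sphere_h_deriv[OF c]]
    by (rule sphere_speed[OF c])
  show "0 < sphere_k c u" if "u \<in> interior {0..?L}"
    using sphere_sin_pos[of u] that c by (simp add: sphere_k_def)
next
  let ?L = "pi / sqrt c"
  fix a assume "a \<in> {0..?L} - interior {0..?L}"
  then have a: "a = 0 \<or> a = ?L" by auto
  then show "sphere_k c a = 0" using c by (auto simp: sphere_k_def)
  have "sin (sqrt c * a) = 0" using a c by auto
  then have d: "(sphere_h c has_real_derivative 0) (at a within {0..?L})"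
    using has_field_derivative_at_within[OF sphere_h_deriv[OF c, of a]] by simp
  have L: "?L > 0" using c by simp
  from a show "smooth_pole {0..?L} (sphere_k c) (sphere_h c) a"
  proof
    assume a0: "a = 0"
    show ?thesis unfolding smooth_pole_def
      by (intro conjI d bexI[of _ 1] exI[of _ ?L]) (use L sphere_pole_smooth[of 1 ?L] in \<open>simp_all add: a0\<close>)
  next
    \<comment> \<open>Run from the far end (s = -1), the surface is the patch at 0 with its height
      reversed.\<close>
    assume aL: "a = ?L"
    have "(\<lambda>w. revolve (sphere_k c) (sphere_h c) (a + -1 * norm w) (Arg w)) =
      (\<lambda>w. revolve (sphere_k c) (\<lambda>u. -1 * sphere_h c u) (norm w) (Arg w))" for w :: complex
      unfolding aL revolve_def by (simp add: sphere_antipode)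
    then have "Cinf_on (\<lambda>w::complex. revolve (sphere_k c) (sphere_h c) (a + -1 * norm w) (Arg w)) (ball 0 ?L)"
      using sphere_pole_smooth[of "-1" ?L] by simp
    then show ?thesis unfolding smooth_pole_def
      using L by (intro conjI d bexI[of _ "-1"] exI[of _ ?L]) (auto simp: aL)
  qed
qed

lemma sphere_complete_revolution_surface:
  "complete_revolution_surface_curv {0..pi / sqrt c} (sphere_k c) (sphere_h c) c"
  unfolding complete_revolution_surface_curv_def
proof (intro conjI sphere_revolution_surface compact_imp_riem_complete)
  let ?L = "pi / sqrt c"
  show "compact {0..?L}" by simp
  \<comment> \<open>The height increases along the profile, which gives the injectivity needed for
    completeness.\<close>
  have "strict_mono_on {0..?L} (sphere_h c)"
  proof (rule strict_mono_onI)
    fix x y assume xy: "x \<in> {0..?L}" "y \<in> {0..?L}" "x < y"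
    show "sphere_h c x < sphere_h c y"
    proof (rule DERIV_pos_imp_increasing_open[OF xy(3)])
      fix z assume "x < z" "z < y"
      then have "0 < sin (sqrt c * z)" using xy by (intro sphere_sin_pos) auto
      then have "0 < sqrt (c + 1) * sin (sqrt c * z) / sqrt (c + (sin (sqrt c * z))\<^sup>2)"
        using c by (simp add: add_pos_nonneg)
      then show "\<exists>D. (sphere_h c has_real_derivative D) (at z) \<and> 0 < D"
        using sphere_h_deriv[OF c] by blast
    next
      show "continuous_on {x..y} (sphere_h c)"
        using DERIV_isCont[OF sphere_h_deriv[OF c]] by (intro continuous_at_imp_continuous_on) blast
    qed
  qed
  then show "inj_on (sphere_h c) {0..?L}" by (rule strict_mono_on_imp_inj_on)
  show "constant_gauss_curvature {0..?L} (sphere_k c) (sphere_h c) c"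
    unfolding constant_gauss_curvature_def
  proof (intro allI impI)
    fix p :: "real^2" assume "p $ 1 \<in> interior {0..?L}"
    then have p: "p $ 1 \<in> {0<..<?L}" by simp
    have "gauss_curvature (induced_metric (\<lambda>q. revolve (sphere_k c) (sphere_h c) (q $ 1) (q $ 2))) p =
      - (- sin (sqrt c * p $ 1) * sqrt c) / sinh (sphere_k c (p $ 1))"
    proof (rule gauss_curvature_revolve[OF open_greaterThanLessThan p sphere_k_deriv[OF c] sphere_h_deriv[OF c] sphere_speed[OF c]])
      show "0 < sphere_k c u" if "u \<in> {0<..<?L}" for u
        using sphere_sin_pos[OF that] c by (simp add: sphere_k_def)
      show "((\<lambda>u. sinh (sphere_k c u)) has_real_derivative cos (sqrt c * u)) (at u)" for u
      proof -
        have "((\<lambda>u. sin (sqrt c * u) / sqrt c) has_real_derivative cos (sqrt c * u) * sqrt c / sqrt c) (at u)"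
          by (rule DERIV_cdivide) (auto intro!: derivative_eq_intros)
        then show ?thesis unfolding sinh_sphere_k using c by simp
      qed
      show "((\<lambda>u. cos (sqrt c * u)) has_real_derivative - sin (sqrt c * u) * sqrt c) (at u)" for u
        by (auto intro!: derivative_eq_intros)
    qed
    also have "\<dots> = c" using sphere_sin_pos[OF p] c by (simp add: sinh_sphere_k)
    finally show "gauss_curvature (induced_metric (\<lambda>q. revolve (sphere_k c) (sphere_h c) (q $ 1) (q $ 2))) p = c" .
  qed
qed

end

section \<open>Vertical isometries and congruence of the spheres\<close>

text \<open>The linear part preserves the form, so composition preserves speeds and lengths, and
  both distances are infima of the same set. The inverse map has the same shape with
  \<open>- e * d\<close> for \<open>d\<close>, which is why the claim about curves quantifies over
  its own \<open>e\<close> and \<open>d\<close>.\<close>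

lemma height_isometry:
  fixes e d :: real
  assumes e: "e \<in> {-1, 1}"
  shows "ambient_isometry (\<lambda>(x, s). (x, e * s + d))"
proof -
  have curves: "(\<lambda>(x, s). (x, e * s + d)) \<circ> \<gamma> \<in> curves_between H2xR (\<lambda>p. p) (fst x, e * snd x + d) (fst y, e * snd y + d)
      \<and> curve_length (\<lambda>p. p) ((\<lambda>(x, s). (x, e * s + d)) \<circ> \<gamma>) = curve_length (\<lambda>p. p) \<gamma>"
    if \<gamma>: "\<gamma> \<in> curves_between H2xR (\<lambda>p. p) x y" and e: "e \<in> {-1, 1}"
    for \<gamma> x y and e d :: real
  proof -
    let ?\<Phi> = "\<lambda>(x::real^3, s). (x, e * s + d)"
    define A where "A p = (fst p :: real^3, e * snd p)" for p :: "(real^3) \<times> real"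
    have A: "bounded_linear A"
      unfolding A_def by (intro bounded_linear_Pair bounded_linear_fst bounded_linear_const_mult bounded_linear_snd)
    have AA: "A (A p) = p" for p using e by (auto simp: A_def)
    have form: "ambient_form (A w) (A w) = ambient_form w w" for w
      using e by (auto simp: A_def ambient_form_def)
    have \<Phi>: "?\<Phi> \<circ> \<gamma> = (\<lambda>t. A (\<gamma> t) + (0, d))" by (auto simp: A_def split_beta)
    have vd: "((?\<Phi> \<circ> \<gamma>) has_vector_derivative A w) (at t)" if "(\<gamma> has_vector_derivative w) (at t)" for w t
      unfolding \<Phi> using bounded_linear.has_vector_derivative[OF A that]
        has_vector_derivative_add_const[of "\<lambda>t. A (\<gamma> t)" "(0, d)"] by simp
    have vd': "(\<gamma> has_vector_derivative A w) (at t)" if "((?\<Phi> \<circ> \<gamma>) has_vector_derivative w) (at t)" for w t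
    proof -
      have "((\<lambda>t. A (\<gamma> t)) has_vector_derivative w) (at t)"
        using that unfolding \<Phi> has_vector_derivative_add_const .
      from bounded_linear.has_vector_derivative[OF A this] show ?thesis by (simp add: AA)
    qed
    \<comment> \<open>Speeds agree even at times without a derivative:
      \<open>vector_derivative\<close> then chooses from the same unsatisfied predicate.\<close>
    have speed: "speed (\<lambda>p. p) (?\<Phi> \<circ> \<gamma>) t = speed (\<lambda>p. p) \<gamma> t" for t
    proof (cases "\<exists>w. (\<gamma> has_vector_derivative w) (at t)")
      case True
      then obtain w where w: "(\<gamma> has_vector_derivative w) (at t)" by blast
      show ?thesis
        using vector_derivative_at[OF w] vector_derivative_at[OF vd[OF w]] by (simp add: speed_def o_def form Let_def)
    next
      case False
      then have "(\<lambda>w. ((?\<Phi> \<circ> \<gamma>) has_vector_derivative w) (at t)) = (\<lambda>w. (\<gamma> has_vector_derivative w) (at t))"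
        using vd' by blast
      then show ?thesis by (simp add: speed_def vector_derivative_def o_def)
    qed
    have "path \<gamma>" "path_image \<gamma> \<subseteq> H2xR" "\<gamma> 0 = x" "\<gamma> 1 = y" "valid_path \<gamma>" "speed (\<lambda>p. p) \<gamma> integrable_on {0..1}"
      using \<gamma> by (simp_all add: curves_between_def pathstart_def pathfinish_def o_def)
    note g = this
    have "valid_path (?\<Phi> \<circ> \<gamma>)"
    proof -
      obtain S where S: "finite S" "\<gamma> C1_differentiable_on {0..1} - S" "continuous_on {0..1} \<gamma>"
        using g(5) by (auto simp: valid_path_def piecewise_C1_differentiable_on_def)
      then obtain D where D: "\<forall>t\<in>{0..1} - S. (\<gamma> has_vector_derivative D t) (at t)" "continuous_on ({0..1} - S) D"
        by (auto simp: C1_differentiable_on_def)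
      have "(?\<Phi> \<circ> \<gamma>) C1_differentiable_on {0..1} - S"
        unfolding C1_differentiable_on_def
        using D vd bounded_linear.continuous_on[OF A D(2)] by (intro exI[of _ "\<lambda>t. A (D t)"]) blast
      moreover have "continuous_on {0..1} (?\<Phi> \<circ> \<gamma>)"
        unfolding \<Phi> by (intro continuous_intros bounded_linear.continuous_on[OF A S(3)])
      ultimately show ?thesis
        unfolding valid_path_def piecewise_C1_differentiable_on_def using S(1) by blast
    qed
    moreover from this have "path (?\<Phi> \<circ> \<gamma>)" by (rule valid_path_imp_path)
    moreover have "path_image (?\<Phi> \<circ> \<gamma>) \<subseteq> H2xR"
      using g(2) by (auto simp: path_image_def H2xR_def image_subset_iff split_beta mem_Times_iff)
    moreover have "speed (\<lambda>p. p) (?\<Phi> \<circ> \<gamma>) = speed (\<lambda>p. p) \<gamma>" using speed by (rule ext)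
    moreover have "(\<lambda>p. p) \<circ> \<eta> = \<eta>" for \<eta> :: "real \<Rightarrow> (real^3) \<times> real" by (simp add: fun_eq_iff)
    ultimately show ?thesis
      using g(3,4,6) by (simp add: curves_between_def pathstart_def pathfinish_def curve_length_def)
        (simp add: split_beta)
  qed
  let ?\<Phi> = "\<lambda>(x::real^3, s). (x, e * s + d)"
  have inv: "e * (e * s + d) - e * d = s" for s using e by (auto simp: algebra_simps)
  have "bij_betw ?\<Phi> H2xR H2xR"
    by (rule bij_betw_byWitness[where f' = "\<lambda>(x, s). (x, e * s + - e * d)"])
      (use e in \<open>auto simp: H2xR_def algebra_simps\<close>)
  moreover have "riem_dist H2xR (\<lambda>p. p) (?\<Phi> x) (?\<Phi> y) = riem_dist H2xR (\<lambda>p. p) x y" for x y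
  proof -
    have "curve_length (\<lambda>p. p) ` curves_between H2xR (\<lambda>p. p) (?\<Phi> x) (?\<Phi> y)
        = curve_length (\<lambda>p. p) ` curves_between H2xR (\<lambda>p. p) x y"
    proof (intro subset_antisym subsetI)
      fix l assume "l \<in> curve_length (\<lambda>p. p) ` curves_between H2xR (\<lambda>p. p) (?\<Phi> x) (?\<Phi> y)"
      then obtain \<gamma> where \<gamma>: "\<gamma> \<in> curves_between H2xR (\<lambda>p. p) (?\<Phi> x) (?\<Phi> y)" "l = curve_length (\<lambda>p. p) \<gamma>" by blast
      have "(fst (?\<Phi> z), e * snd (?\<Phi> z) + - e * d) = z" for z by (simp add: split_beta inv)
      then show "l \<in> curve_length (\<lambda>p. p) ` curves_between H2xR (\<lambda>p. p) x y"
        using curves[OF \<gamma>(1) e, of "- e * d"] \<gamma>(2) by (metis (no_types, lifting) image_eqI)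
    next
      fix l assume "l \<in> curve_length (\<lambda>p. p) ` curves_between H2xR (\<lambda>p. p) x y"
      then obtain \<gamma> where \<gamma>: "\<gamma> \<in> curves_between H2xR (\<lambda>p. p) x y" "l = curve_length (\<lambda>p. p) \<gamma>" by blast
      then show "l \<in> curve_length (\<lambda>p. p) ` curves_between H2xR (\<lambda>p. p) (?\<Phi> x) (?\<Phi> y)"
        using curves[OF \<gamma>(1) e, of d]
        by (intro image_eqI[where x = "?\<Phi> \<circ> \<gamma>"]) (simp_all add: split_beta)
    qed
    then show ?thesis by (simp only: riem_dist_def)
  qed
  ultimately show ?thesis by (auto simp: ambient_isometry_def)
qed

text \<open>Translating the parameter matches the two surfaces. As \<open>e * e = 1\<close>, the
  common height is H = e (h - d); inserting it into the second profile gives the vertical map with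
  slope \<open>e' * e\<close>.\<close>

lemma sphere_congruent:
  fixes F :: "real \<Rightarrow> real" and H :: "real \<Rightarrow> real"
  assumes e: "e \<in> {-1, 1}" "e' \<in> {-1, 1}" and I: "I = {a..a + L}" "J = {a'..a' + L}"
    and k: "\<And>u. u \<in> I \<Longrightarrow> k u = F (u - a)" "\<And>u. u \<in> I \<Longrightarrow> h u = e * H (u - a) + d"
    and l: "\<And>u. u \<in> J \<Longrightarrow> l u = F (u - a')" "\<And>u. u \<in> J \<Longrightarrow> g u = e' * H (u - a') + d'"
  shows "congruent_immersions (rev_surface I k) (rev_immersion k h) (rev_surface J l) (rev_immersion l g)"
  unfolding congruent_immersions_def
proof (intro exI conjI ballI)
  let ?\<phi> = "\<lambda>s (u, p). (u + s, p :: real \<times> real) :: real \<times> real \<times> real"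
  show "ambient_isometry (\<lambda>(x, s). (x, (e' * e) * s + (d' - e' * e * d)))"
    using e by (intro height_isometry) auto
  have cont: "continuous_on M (?\<phi> s)" for M s
    unfolding split_beta by (intro continuous_intros)
  have 1: "?\<phi> (a' - a) ` rev_surface I k \<subseteq> rev_surface J l"
    by (force simp: rev_surface_def I k(1) l(1))
  have 2: "?\<phi> (a - a') ` rev_surface J l \<subseteq> rev_surface I k"
    by (force simp: rev_surface_def I k(1) l(1))
  show "homeomorphism (rev_surface I k) (rev_surface J l) (?\<phi> (a' - a)) (?\<phi> (a - a'))"
    by (rule homeomorphismI[OF cont cont 1 2]) auto
  fix x assume "x \<in> rev_surface I k"
  then obtain u y z where x: "x = (u, y, z)" and u: "u \<in> I" by (auto simp: rev_surface_def)
  then have u': "u + (a' - a) \<in> J" by (auto simp: I)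
  have "e * e = 1" using e by auto
  then have "g (u + (a' - a)) = e' * e * h u + (d' - e' * e * d)"
    using k(2)[OF u] l(2)[OF u'] by (simp add: algebra_simps)
  then show "rev_immersion l g (?\<phi> (a' - a) x) = (\<lambda>(x, s). (x, (e' * e) * s + (d' - e' * e * d))) (rev_immersion k h x)"
    using k(1)[OF u] l(1)[OF u'] by (simp add: x rev_immersion_def)
qed

lemma complete_revolution_surface_curvD:
  assumes "complete_revolution_surface_curv I k h K"
  shows "revolution_surface I k h" "constant_gauss_curvature I k h K" "closed I"
  using assms riem_complete_imp_closed[of I k h] by (simp_all add: complete_revolution_surface_curv_def)

theorem mainTheorem5:
  shows "(\<forall>K::real. (\<exists>I k h. complete_revolution_surface_curv I k h K) \<longrightarrow> K \<ge> -1) \<and>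
    (\<forall>c::real. c > 0 \<longrightarrow>
       (\<exists>I k h. complete_revolution_surface_curv I k h c) \<and>
       (\<forall>I k h J l g.
          complete_revolution_surface_curv I k h c \<and> complete_revolution_surface_curv J l g c \<longrightarrow>
          congruent_immersions (rev_surface I k) (rev_immersion k h)
                               (rev_surface J l) (rev_immersion l g)))"
proof (intro conjI allI impI)
  fix K :: real assume "\<exists>I k h. complete_revolution_surface_curv I k h K"
  then obtain I k h where "complete_revolution_surface_curv I k h K" by blast
  then show "K \<ge> -1"
    using closed_imp_curvature_ge[of I k h K] complete_revolution_surface_curvD[of I k h K] by blast
next
  fix c :: real assume "c > 0"
  then show "\<exists>I k h. complete_revolution_surface_curv I k h c"
    using sphere_complete_revolution_surface by blast
next
  fix c :: real and I k h J l g
  assume c: "c > 0" and *: "complete_revolution_surface_curv I k h c \<and> complete_revolution_surface_curv J l g c"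
  note 1 = complete_revolution_surface_curvD[OF conjunct1[OF *]]
    and 2 = complete_revolution_surface_curvD[OF conjunct2[OF *]]
  obtain a e d where I: "e \<in> {-1, 1}" "I = {a..a + pi / sqrt c}"
    "\<And>u. u \<in> I \<Longrightarrow> k u = sphere_k c (u - a)" "\<And>u. u \<in> I \<Longrightarrow> h u = e * sphere_h c (u - a) + d"
    by (rule positive_curvature_sphere[OF 1(1,2) c 1(3)]) (rule that)
  obtain a' e' d' where J: "e' \<in> {-1, 1}" "J = {a'..a' + pi / sqrt c}"
    "\<And>u. u \<in> J \<Longrightarrow> l u = sphere_k c (u - a')" "\<And>u. u \<in> J \<Longrightarrow> g u = e' * sphere_h c (u - a') + d'"
    by (rule positive_curvature_sphere[OF 2(1,2) c 2(3)]) (rule that)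
  show "congruent_immersions (rev_surface I k) (rev_immersion k h) (rev_surface J l) (rev_immersion l g)"
    by (rule sphere_congruent[OF I(1) J(1) I(2) J(2) I(3,4) J(3,4)])
qed

end
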